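(* Let $(\mathfrak g,\theta)$ be of type CII (resp. DIII), and let $e\in\mathfrak p$ be nilpotent. Then $e$ is $\mathfrak p$-distinguished if and only if its $ab$-diagram satisfies: for each even (resp. odd) length $d$, there are either no rows of length $d$ or exactly two rows of length $d$ (necessarily one beginning with $a$ and the other with $b$); and for each odd (resp. even) length $d$, all rows of length $d$ begin with the same letter. Moreover, every almost $\mathfrak p$-distinguished element is $\mathfrak p$-distinguished.
   Context: Base field $\Bbbk$ algebraically closed of characteristic $0$; $V$ a finite-dimensional vector space with a nondegenerate bilinear form $\Phi$; $\mathfrak g=\mathrm{aut}(V,\Phi)$ is the Lie algebra preserving $\Phi$, assumed simple; $J\in GL(V)$ preserves $\Phi$ ($\Phi(Ju,Jv)=\Phi(u,v)$) and $\theta(x)=JxJ^{-1}$ is a nontrivial involution of $\mathfrak g$, with $\pm1$-eigenspaces $\mathfrak k,\mathfrak p$. Type CII: $\Phi$ alternating, $J^2=\mathrm{Id}$ (so $(\mathfrak g,\mathfrak k)=(\mathfrak{sp}_n,\mathfrak{sp}_p\times\mathfrak{sp}_q)$). Type DIII: $\Phi$ symmetric, $J^2=-\mathrm{Id}$ (so $(\mathfrak g,\mathfrak k)=(\mathfrak{so}_n,\mathfrak{gl}_{n/2})$). $V=V_a\oplus V_b$ is the decomposition of $V$ into the two eigenspaces of $J$. $\mathcal N$ is the set of nilpotent elements in $\mathfrak p$; $\mathfrak p^e=\{y\in\mathfrak p:[e,y]=0\}$. For $0\ne e\in\mathcal N$ choose a normal $\mathfrak{sl}_2$-triple $(e,h,f)$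 ($e,f\in\mathfrak p$, $h\in\mathfrak k$, $[h,e]=2e$, $[h,f]=-2f$, $[e,f]=h$) and let $\mathfrak p(e,0)=\{y\in\mathfrak p^e:[h,y]=0\}$; for $e=0$ put $\mathfrak p(0,0)=\mathfrak p$. $e$ is $\mathfrak p$-distinguished if $\mathfrak p^e\subset\mathcal N$; almost $\mathfrak p$-distinguished if $\mathfrak p(e,0)$ contains no nonzero nilpotent element. $ab$-diagram of $e$: the Young diagram whose row lengths are the Jordan block sizes of $e$ on $V$, each row being associated with a Jordan string $v,ev,\dots,e^{d-1}v$ ($e^dv=0$) from a basis of $V$ adapted to the triple ($v$ a lowest weight vector) and diagonalizing $J$; a box is filled with $a$ or $b$ according to whether the corresponding basis vector is in $V_a$ or $V_b$ (letters alternate along a row). The number of rows of length $d$ beginning with $a$ (resp. $b$) is $\dim(H'_d\cap V_a)$ (resp. $\dim (H'_d\cap V_b)$), where $H'_d=\{v\in V: fv=0,\ hv=-(d-1)v\}$ (for $e=0$, $H_1'=V$). *)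

theory Defs
  imports "HOL-Computational_Algebra.Computational_Algebra"
begin

text \<open>
  The base field is a type \<open>'k\<close>, and \<open>V\<close> is the whole type \<open>'v\<close>, with scalar multiplication
  \<open>scale\<close>. Endomorphisms of \<open>V\<close> are functions \<open>'v \<Rightarrow> 'v\<close> that are linear; the zero operator is
  \<open>\<lambda>_. 0\<close>, and sums and multiples of operators are written pointwise.
\<close>

definition lie_bracket :: "('v::ab_group_add \<Rightarrow> 'v) \<Rightarrow> ('v \<Rightarrow> 'v) \<Rightarrow> 'v \<Rightarrow> 'v" where
  "lie_bracket x y = (\<lambda>v. x (y v) - y (x v))"

definition bilinear_form ::
  "('k::field \<Rightarrow> 'v::ab_group_add \<Rightarrow> 'v) \<Rightarrow> ('v \<Rightarrow> 'v \<Rightarrow> 'k) \<Rightarrow> bool" where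
  "bilinear_form scale \<Phi> \<longleftrightarrow>
     (\<forall>u. Vector_Spaces.linear scale (*) (\<lambda>v. \<Phi> u v)) \<and>
     (\<forall>v. Vector_Spaces.linear scale (*) (\<lambda>u. \<Phi> u v))"

definition nondegenerate_form :: "('v::ab_group_add \<Rightarrow> 'v \<Rightarrow> 'k::field) \<Rightarrow> bool" where
  "nondegenerate_form \<Phi> \<longleftrightarrow>
     (\<forall>u. (\<forall>v. \<Phi> u v = 0) \<longrightarrow> u = 0) \<and> (\<forall>v. (\<forall>u. \<Phi> u v = 0) \<longrightarrow> v = 0)"

definition aut_algebra ::
  "('k::field \<Rightarrow> 'v::ab_group_add \<Rightarrow> 'v) \<Rightarrow> ('v \<Rightarrow> 'v \<Rightarrow> 'k) \<Rightarrow> ('v \<Rightarrow> 'v) set" where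
  "aut_algebra scale \<Phi> =
     {x. Vector_Spaces.linear scale scale x \<and> (\<forall>u v. \<Phi> (x u) v + \<Phi> u (x v) = 0)}"

definition lie_ideal ::
  "('k::field \<Rightarrow> 'v::ab_group_add \<Rightarrow> 'v) \<Rightarrow> ('v \<Rightarrow> 'v) set \<Rightarrow> ('v \<Rightarrow> 'v) set \<Rightarrow> bool" where
  "lie_ideal scale \<gg> I \<longleftrightarrow>
     I \<subseteq> \<gg> \<and> (\<lambda>_. 0) \<in> I \<and>
     (\<forall>x\<in>I. \<forall>y\<in>I. (\<lambda>v. x v + y v) \<in> I) \<and>
     (\<forall>c. \<forall>x\<in>I. (\<lambda>v. scale c (x v)) \<in> I) \<and>
     (\<forall>x\<in>\<gg>. \<forall>y\<in>I. lie_bracket x y \<in> I)"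

definition simple_lie_algebra ::
  "('k::field \<Rightarrow> 'v::ab_group_add \<Rightarrow> 'v) \<Rightarrow> ('v \<Rightarrow> 'v) set \<Rightarrow> bool" where
  "simple_lie_algebra scale \<gg> \<longleftrightarrow>
     (\<exists>x\<in>\<gg>. \<exists>y\<in>\<gg>. lie_bracket x y \<noteq> (\<lambda>_. 0)) \<and>
     (\<forall>I. lie_ideal scale \<gg> I \<longrightarrow> I = {\<lambda>_. 0} \<or> I = \<gg>)"

definition theta :: "('v \<Rightarrow> 'v) \<Rightarrow> ('v \<Rightarrow> 'v) \<Rightarrow> 'v \<Rightarrow> 'v" where
  "theta J x = J \<circ> x \<circ> inv J"

locale simple_symmetric_pair = finite_dimensional_vector_space scale Basis
  for scale :: "'k::{alg_closed_field, field_char_0} \<Rightarrow> 'v::ab_group_add \<Rightarrow> 'v"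
    and Basis :: "'v set" +
  fixes \<Phi> :: "'v \<Rightarrow> 'v \<Rightarrow> 'k" and J :: "'v \<Rightarrow> 'v"
  assumes form_bilinear: "bilinear_form scale \<Phi>"
    and form_nondegenerate: "nondegenerate_form \<Phi>"
    and aut_simple: "simple_lie_algebra scale (aut_algebra scale \<Phi>)"
    and J_linear: "Vector_Spaces.linear scale scale J"
    and J_bij: "bij J"
    and J_preserves: "\<Phi> (J u) (J v) = \<Phi> u v"
    and theta_involution: "x \<in> aut_algebra scale \<Phi> \<Longrightarrow> theta J (theta J x) = x"
    and theta_nontrivial: "\<exists>x\<in>aut_algebra scale \<Phi>. theta J x \<noteq> x"

definition type_CII :: "('v::ab_group_add \<Rightarrow> 'v \<Rightarrow> 'k::field) \<Rightarrow> ('v \<Rightarrow> 'v) \<Rightarrow> bool" where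
  "type_CII \<Phi> J \<longleftrightarrow> (\<forall>v. \<Phi> v v = 0) \<and> (\<forall>v. J (J v) = v)"

definition type_DIII :: "('v::ab_group_add \<Rightarrow> 'v \<Rightarrow> 'k::field) \<Rightarrow> ('v \<Rightarrow> 'v) \<Rightarrow> bool" where
  "type_DIII \<Phi> J \<longleftrightarrow> (\<forall>u v. \<Phi> u v = \<Phi> v u) \<and> (\<forall>v. J (J v) = - v)"

text \<open>
  Which of the two eigenspaces is called \<open>V\<^sub>a\<close> is left open: \<open>\<alpha>\<close> and \<open>\<beta>\<close> may be interchanged.
\<close>

definition eigenspace_decomposition ::
  "('k::field \<Rightarrow> 'v::ab_group_add \<Rightarrow> 'v) \<Rightarrow> ('v \<Rightarrow> 'v) \<Rightarrow> 'v set \<Rightarrow> 'v set \<Rightarrow> bool" where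
  "eigenspace_decomposition scale J Va Vb \<longleftrightarrow>
     (\<exists>\<alpha> \<beta>. \<alpha> \<noteq> \<beta> \<and> Va = {v. J v = scale \<alpha> v} \<and> Vb = {v. J v = scale \<beta> v}) \<and>
     Va \<inter> Vb = {0} \<and> (\<forall>v. \<exists>a\<in>Va. \<exists>b\<in>Vb. v = a + b)"

definition k_part ::
  "('k::field \<Rightarrow> 'v::ab_group_add \<Rightarrow> 'v) \<Rightarrow> ('v \<Rightarrow> 'v \<Rightarrow> 'k) \<Rightarrow> ('v \<Rightarrow> 'v) \<Rightarrow> ('v \<Rightarrow> 'v) set" where
  "k_part scale \<Phi> J = {x \<in> aut_algebra scale \<Phi>. theta J x = x}"

definition p_part ::
  "('k::field \<Rightarrow> 'v::ab_group_add \<Rightarrow> 'v) \<Rightarrow> ('v \<Rightarrow> 'v \<Rightarrow> 'k) \<Rightarrow> ('v \<Rightarrow> 'v) \<Rightarrow> ('v \<Rightarrow> 'v) set" where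
  "p_part scale \<Phi> J = {x \<in> aut_algebra scale \<Phi>. theta J x = (\<lambda>v. - x v)}"

definition nilpotent_cone ::
  "('k::field \<Rightarrow> 'v::ab_group_add \<Rightarrow> 'v) \<Rightarrow> ('v \<Rightarrow> 'v \<Rightarrow> 'k) \<Rightarrow> ('v \<Rightarrow> 'v) \<Rightarrow> ('v \<Rightarrow> 'v) set" where
  "nilpotent_cone scale \<Phi> J = {x \<in> p_part scale \<Phi> J. \<exists>m::nat. x ^^ m = (\<lambda>_. 0)}"

definition p_centralizer ::
  "('k::field \<Rightarrow> 'v::ab_group_add \<Rightarrow> 'v) \<Rightarrow> ('v \<Rightarrow> 'v \<Rightarrow> 'k) \<Rightarrow> ('v \<Rightarrow> 'v) \<Rightarrow>
     ('v \<Rightarrow> 'v) \<Rightarrow> ('v \<Rightarrow> 'v) set" where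
  "p_centralizer scale \<Phi> J e = {y \<in> p_part scale \<Phi> J. lie_bracket e y = (\<lambda>_. 0)}"

definition is_normal_triple ::
  "('k::field \<Rightarrow> 'v::ab_group_add \<Rightarrow> 'v) \<Rightarrow> ('v \<Rightarrow> 'v \<Rightarrow> 'k) \<Rightarrow> ('v \<Rightarrow> 'v) \<Rightarrow>
     ('v \<Rightarrow> 'v) \<Rightarrow> ('v \<Rightarrow> 'v) \<Rightarrow> ('v \<Rightarrow> 'v) \<Rightarrow> bool" where
  "is_normal_triple scale \<Phi> J e h f \<longleftrightarrow>
     e \<in> p_part scale \<Phi> J \<and> f \<in> p_part scale \<Phi> J \<and> h \<in> k_part scale \<Phi> J \<and>
     lie_bracket h e = (\<lambda>v. scale 2 (e v)) \<and>
     lie_bracket h f = (\<lambda>v. scale (-2) (f v)) \<and>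
     lie_bracket e f = h"

text \<open>
  The chosen normal triple of \<open>e\<close>, as the pair of its members \<open>h\<close> and \<open>f\<close>. It exists for every
  nilpotent \<open>e \<noteq> 0\<close> in the \<open>-1\<close>-eigenspace, by the theorem of Jacobson--Morozov in the form of
  Kostant--Rallis. For \<open>e = 0\<close> the operators \<open>h\<close> and \<open>f\<close> are set to zero.
\<close>

definition normal_triple ::
  "('k::field \<Rightarrow> 'v::ab_group_add \<Rightarrow> 'v) \<Rightarrow> ('v \<Rightarrow> 'v \<Rightarrow> 'k) \<Rightarrow> ('v \<Rightarrow> 'v) \<Rightarrow>
     ('v \<Rightarrow> 'v) \<Rightarrow> ('v \<Rightarrow> 'v) \<times> ('v \<Rightarrow> 'v)" where
  "normal_triple scale \<Phi> J e =
     (if e = (\<lambda>_. 0) then ((\<lambda>_. 0), (\<lambda>_. 0))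
      else (SOME (h, f). is_normal_triple scale \<Phi> J e h f))"

definition p_reductive_part ::
  "('k::field \<Rightarrow> 'v::ab_group_add \<Rightarrow> 'v) \<Rightarrow> ('v \<Rightarrow> 'v \<Rightarrow> 'k) \<Rightarrow> ('v \<Rightarrow> 'v) \<Rightarrow>
     ('v \<Rightarrow> 'v) \<Rightarrow> ('v \<Rightarrow> 'v) set" where
  "p_reductive_part scale \<Phi> J e =
     (if e = (\<lambda>_. 0) then p_part scale \<Phi> J
      else {y \<in> p_centralizer scale \<Phi> J e.
              lie_bracket (fst (normal_triple scale \<Phi> J e)) y = (\<lambda>_. 0)})"

definition p_distinguished ::
  "('k::field \<Rightarrow> 'v::ab_group_add \<Rightarrow> 'v) \<Rightarrow> ('v \<Rightarrow> 'v \<Rightarrow> 'k) \<Rightarrow> ('v \<Rightarrow> 'v) \<Rightarrow> ('v \<Rightarrow> 'v) \<Rightarrow> bool"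
  where
  "p_distinguished scale \<Phi> J e \<longleftrightarrow> p_centralizer scale \<Phi> J e \<subseteq> nilpotent_cone scale \<Phi> J"

definition almost_p_distinguished ::
  "('k::field \<Rightarrow> 'v::ab_group_add \<Rightarrow> 'v) \<Rightarrow> ('v \<Rightarrow> 'v \<Rightarrow> 'k) \<Rightarrow> ('v \<Rightarrow> 'v) \<Rightarrow> ('v \<Rightarrow> 'v) \<Rightarrow> bool"
  where
  "almost_p_distinguished scale \<Phi> J e \<longleftrightarrow>
     (\<forall>y \<in> p_reductive_part scale \<Phi> J e. y \<in> nilpotent_cone scale \<Phi> J \<longrightarrow> y = (\<lambda>_. 0))"

text \<open>
  The space \<open>H'\<^sub>d\<close> of lowest weight vectors of the \<open>d\<close>-dimensional simple submodules. For \<open>e = 0\<close>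
  the convention \<open>h = f = 0\<close> gives \<open>H'\<^sub>1 = V\<close> and \<open>H'\<^sub>d = 0\<close> for \<open>d \<ge> 2\<close>.
\<close>

definition lowest_weight_space ::
  "('k::field \<Rightarrow> 'v::ab_group_add \<Rightarrow> 'v) \<Rightarrow> ('v \<Rightarrow> 'v \<Rightarrow> 'k) \<Rightarrow> ('v \<Rightarrow> 'v) \<Rightarrow>
     ('v \<Rightarrow> 'v) \<Rightarrow> nat \<Rightarrow> 'v set" where
  "lowest_weight_space scale \<Phi> J e d =
     (case normal_triple scale \<Phi> J e of (h, f) \<Rightarrow>
       {v. f v = 0 \<and> h v = scale (- (of_nat d - 1)) v})"

text \<open>
  The \<open>ab\<close>-diagram of \<open>e\<close>, up to the order of its rows: the number of its rows of length \<open>d \<ge> 1\<close>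
  beginning with a given letter. A row is the Jordan string of its first box, which is a vector of
  a basis of \<open>H'\<^sub>d\<close> diagonalizing \<open>J\<close>.
\<close>

datatype ab_letter = LetterA | LetterB

definition ab_diagram ::
  "('k::field \<Rightarrow> 'v::ab_group_add \<Rightarrow> 'v) \<Rightarrow> ('v \<Rightarrow> 'v \<Rightarrow> 'k) \<Rightarrow> ('v \<Rightarrow> 'v) \<Rightarrow>
     'v set \<Rightarrow> 'v set \<Rightarrow> ('v \<Rightarrow> 'v) \<Rightarrow> nat \<Rightarrow> ab_letter \<Rightarrow> nat" where
  "ab_diagram scale \<Phi> J Va Vb e d c =
     vector_space.dim scale
       (lowest_weight_space scale \<Phi> J e d \<inter> (case c of LetterA \<Rightarrow> Va | LetterB \<Rightarrow> Vb))"

definition rows_of_length :: "(nat \<Rightarrow> ab_letter \<Rightarrow> nat) \<Rightarrow> nat \<Rightarrow> nat" where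
  "rows_of_length D d = D d LetterA + D d LetterB"

definition same_first_letter :: "(nat \<Rightarrow> ab_letter \<Rightarrow> nat) \<Rightarrow> nat \<Rightarrow> bool" where
  "same_first_letter D d \<longleftrightarrow> (\<exists>c. \<forall>c'. c' \<noteq> c \<longrightarrow> D d c' = 0)"

end

theory Submission
  imports Defs "HOL-Library.Function_Algebras"
begin

text \<open>
  Put \<open>\<epsilon> = -1\<close> for CII and \<open>\<epsilon> = 1\<close> for DIII, so that \<open>\<Phi>\<close> is \<open>\<epsilon>\<close>-symmetric and \<open>J\<^sup>2 = -\<epsilon>\<close>.
  On the space \<open>H'\<^sub>d\<close> of lowest weight vectors the form \<open>(u, v) \<mapsto> \<Phi> u (e\<^sup>d\<^sup>-\<^sup>1 v)\<close> is nondegenerate,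
  symmetric or alternating according to the sign \<open>(-1)\<^sup>d\<^sup>-\<^sup>1\<epsilon>\<close>; in the symmetric case it pairs the two
  eigenspaces of \<open>J\<close> with each other, in the alternating case each with itself.
  If the diagram violates the condition at \<open>d\<close>, a hyperbolic plane in \<open>H'\<^sub>d\<close> gives both a nonzero
  nilpotent and a non-nilpotent element of the reductive part of the centralizer, as explicit sums of
  rank one operators \<open>\<Phi>(\<cdot>, e\<^sup>i w) e\<^sup>j u\<close>.
  If the condition holds everywhere, then \<open>\<Phi> (y v) (e\<^sup>d\<^sup>-\<^sup>1 u) = 0\<close> on \<open>H'\<^sub>d\<close> for every \<open>y\<close> in the
  centralizer, so \<open>y\<close> strictly raises the filtration of \<open>V\<close> by weights.
  Normal triples are obtained from \<open>[[e, f], e] = 2e\<close>, an equation affine in \<open>f\<close>, by averaging and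
  Morozov's lemma.
\<close>

subsection \<open>Representations of sl(2)\<close>

text \<open>The parity of a row length d enters only through the sign of the form on
  \<open>H'_d\<close>, so both types run through one argument, indexed by \<open>m = d - 1\<close>.
  The converse is shaped by the fact that an element \<open>y\<close> of the centralizer need not
  commute with \<open>h\<close>, hence need not preserve \<open>H'_d\<close>. Pairing
  \<open>y v\<close> with \<open>e^m u\<close>, for u and v in \<open>H'_d\<close>, detects only the
  weight -m component of \<open>y v\<close>, and the task is to show that this leading term
  vanishes. A bad diagram spoils both notions through the same vectors of \<open>H'_d\<close>, so
  the step from almost distinguished to distinguished needs no separate argument. The sl(2) theory
  rests on nilpotency of one operator \<open>E\<close>: the kernel of \<open>E\<close> is filtered
  by the ranges of \<open>E^m\<close>, and \<open>H\<close> acts on the m-th layer as m. The same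
  filtration serves V and the adjoint operators from which a normal triple is still to be
  produced.\<close>

lemma (in vector_space) span_inductI [consumes 1, case_names zero base add scale]:
  assumes "x \<in> span S" "P 0" "\<And>x. x \<in> S \<Longrightarrow> P x"
    "\<And>x y. P x \<Longrightarrow> P y \<Longrightarrow> P (x + y)" "\<And>c x. P x \<Longrightarrow> P (scale c x)"
  shows "P x"
  using assms(1)
proof (induction rule: span_induct)
  case base
  show ?case
    unfolding subspace_def using assms by auto
qed (use assms in auto)

lemma (in vector_space) linear_pow:
  "Vector_Spaces.linear scale scale f \<Longrightarrow> Vector_Spaces.linear scale scale (f ^^ n)"
proof (induction n)
  case (Suc n)
  then show ?case using Vector_Spaces.linear_compose[of scale scale "f ^^ n" scale f]
    by (simp only: funpow.simps)
qed (simp add: linear_id)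

lemma (in vector_space) scale_2: "scale 2 x = x + x"
  using scale_left_distrib[of 1 1 x] by simp

lemma (in vector_space) scale_mult_2: "scale (a * 2) x = scale a x + scale a x"
  using scale_left_distrib[of a a x] by (simp add: mult_2_right)

text \<open>Only two of the sl(2) relations: \<open>H F - F H = - 2 F\<close> is left out, because
  the results up to Morozov's lemma must apply to the operators \<open>ad e\<close>,
  \<open>ad h\<close>, \<open>ad f1\<close> before \<open>f1\<close> has been corrected to satisfy
  it.\<close>

locale raising_pair = vector_space scale
  for scale :: "'k::field_char_0 \<Rightarrow> 'v::ab_group_add \<Rightarrow> 'v" +
  fixes E H F :: "'v \<Rightarrow> 'v"
  assumes linE: "Vector_Spaces.linear scale scale E"
    and linH: "Vector_Spaces.linear scale scale H"
    and linF: "Vector_Spaces.linear scale scale F"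
    and HE: "H (E x) = E (H x) + scale 2 (E x)"
    and EF: "E (F x) = F (E x) + H x"
begin

sublocale E: Vector_Spaces.linear scale scale E by (rule linE)
sublocale H: Vector_Spaces.linear scale scale H by (rule linH)
sublocale F: Vector_Spaces.linear scale scale F by (rule linF)

lemma pow_E_0 [simp]: "(E ^^ j) 0 = 0"
  by (induction j) auto

lemma pow_F_0 [simp]: "(F ^^ j) 0 = 0"
  by (induction j) auto

lemma pow_E_F:
  "(E ^^ Suc m) (F x) = F ((E ^^ Suc m) x)
    + scale (of_nat (Suc m)) (H ((E ^^ m) x) - scale (of_nat m) ((E ^^ m) x))"
proof (induction m)
  case 0
  show ?case by (simp add: EF)
next
  case (Suc m)
  define y where "y = (E ^^ m) x"
  have "(E ^^ Suc (Suc m)) (F x) = E ((E ^^ Suc m) (F x))" by simp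
  also have "\<dots> = E (F (E y)) + scale (of_nat (Suc m)) (E (H y) - scale (of_nat m) (E y))"
    by (simp only: Suc) (simp add: E.add E.scale E.diff y_def)
  also have "E (F (E y)) = F (E (E y)) + H (E y)" by (rule EF)
  also have "E (H y) = H (E y) - scale 2 (E y)" by (simp add: HE)
  finally show ?case
    by (simp add: y_def algebra_simps scale_2 scale_mult_2)
qed

lemma E_H_ker: "E x = 0 \<Longrightarrow> E (H x) = 0"
  using HE[of x] by simp

text \<open>Filter the kernel of \<open>E\<close> by its intersections with the ranges of
  \<open>E^m\<close>: \<open>H\<close> acts on the m-th layer as the scalar m modulo the next layer.
  In characteristic 0 this replaces eigenvalue theory for \<open>H\<close> on the kernel.\<close>

lemma ker_E_shift:
  assumes "E ((E ^^ m) w) = 0"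
  shows "H ((E ^^ m) w) - scale (of_nat m) ((E ^^ m) w)
      = (E ^^ Suc m) (scale (inverse (of_nat (Suc m))) (F w))"
proof -
  interpret Em: Vector_Spaces.linear scale scale "E ^^ Suc m" by (intro linear_pow linE)
  have "scale (of_nat (Suc m)) (H ((E ^^ m) w) - scale (of_nat m) ((E ^^ m) w)) = (E ^^ Suc m) (F w)"
    using pow_E_F[of m w] assms by simp
  then have "H ((E ^^ m) w) - scale (of_nat m) ((E ^^ m) w)
      = scale (inverse (of_nat (Suc m))) ((E ^^ Suc m) (F w))"
    by (metis of_nat_eq_0_iff nat.distinct(1) left_inverse scale_one scale_scale)
  then show "H ((E ^^ m) w) - scale (of_nat m) ((E ^^ m) w)
      = (E ^^ Suc m) (scale (inverse (of_nat (Suc m))) (F w))"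
    by (simp only: Em.scale)
qed

text \<open>Each \<open>c - m\<close> can be inverted, which pushes \<open>x\<close> from the range
  of \<open>E^m\<close> into that of \<open>E^(m+1)\<close>, and so finally into the zero range of
  \<open>E^N\<close>.\<close>

lemma ker_E_weight_nat:
  assumes nil: "\<And>x. (E ^^ N) x = 0" and "E x = 0" "H x = scale c x" "\<And>m. c \<noteq> of_nat m"
  shows "x = 0"
proof -
  have "\<exists>w. x = (E ^^ m) w" for m
  proof (induction m)
    case (Suc m)
    then obtain w where w: "x = (E ^^ m) w" by blast
    with assms obtain w' where "H x - scale (of_nat m) x = (E ^^ Suc m) w'"
      using ker_E_shift by metis
    then have w': "scale (c - of_nat m) x = (E ^^ Suc m) w'"
      by (simp add: assms scale_left_diff_distrib)
    interpret Em: Vector_Spaces.linear scale scale "E ^^ Suc m" by (intro linear_pow linE)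
    have "x = (E ^^ Suc m) (scale (inverse (c - of_nat m)) w')"
      using assms(4)[of m] by (simp only: Em.scale flip: w') simp
    then show ?case by blast
  qed simp
  then show ?thesis using nil by metis
qed

text \<open>Morozov's lemma: on the kernel of \<open>E\<close> the eigenvalues of \<open>H\<close>
  are natural numbers, so \<open>H + 2\<close> is invertible there. The induction descends through
  the layers, and the subspace \<open>S\<close> is carried along so that the solution can be kept
  inside \<open>p_part\<close>.\<close>

lemma H_plus_2_surj_on_ker_E:
  assumes nil: "\<And>x. (E ^^ N) x = 0"
    and S: "subspace S" "\<And>x. x \<in> S \<Longrightarrow> H x \<in> S"
    and z: "z \<in> S" "E z = 0"
  shows "\<exists>z'\<in>S. E z' = 0 \<and> H z' + scale 2 z' = z"
proof -
  have "\<forall>z\<in>S. E z = 0 \<longrightarrow> (\<exists>w. z = (E ^^ m) w) \<longrightarrow> (\<exists>z'\<in>S. E z' = 0 \<and> H z' + scale 2 z' = z)"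
    if "m \<le> N" for m
    using that
  proof (induction rule: inc_induct)
    case base
    show ?case using nil S by (auto intro!: bexI[of _ 0] subspace_0)
  next
    case (step m)
    show ?case
    proof (intro ballI impI)
      fix z assume z: "z \<in> S" "E z = 0" and "\<exists>w. z = (E ^^ m) w"
      then obtain w where w: "z = (E ^^ m) w" by blast
      define z1 where "z1 = H z - scale (of_nat m) z"
      have "\<exists>w'. z1 = (E ^^ Suc m) w'"
        using ker_E_shift[of m w] z w unfolding z1_def by blast
      moreover have "z1 \<in> S" "E z1 = 0"
        using z S by (auto simp: z1_def E.diff E.scale E_H_ker intro!: subspace_diff subspace_scale)
      ultimately obtain z2 where z2: "z2 \<in> S" "E z2 = 0" "H z2 + scale 2 z2 = z1"
        using step.IH by blast
      \<comment> \<open>Write \<open>H + 2 = (H - m) + (m + 2)\<close>: the first summand moves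
        \<open>z\<close> to the next layer, where \<open>z2\<close> solves the equation; the second
        is this nonzero scalar.\<close>
      define c :: 'k where "c = of_nat m + 2"
      have "c = of_nat (m + 2)" by (simp add: c_def)
      then have c: "c \<noteq> 0" by (simp only: of_nat_eq_0_iff)
      define z' where "z' = scale (inverse c) (z - z2)"
      have "H (z - z2) + scale 2 (z - z2) = H z + scale 2 z - z1"
        using z2(3) by (simp add: H.diff scale_right_diff_distrib algebra_simps)
      also have "\<dots> = scale c z"
        by (simp add: z1_def c_def scale_left_distrib algebra_simps)
      finally have "H z' + scale 2 z' = scale (inverse c) (scale c z)"
        unfolding z'_def by (simp only: H.scale scale_left_commute[of 2] flip: scale_right_distrib)
      then have "H z' + scale 2 z' = z" using c by simp
      moreover have "z' \<in> S" "E z' = 0"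
        using z z2 S by (auto simp: z'_def E.diff E.scale intro!: subspace_diff subspace_scale)
      ultimately show "\<exists>z'\<in>S. E z' = 0 \<and> H z' + scale 2 z' = z" by blast
    qed
  qed
  from this[of 0] z show ?thesis by auto
qed

definition highest :: "nat \<Rightarrow> 'v set" where
  "highest k = {v. E v = 0 \<and> H v = scale (of_nat k) v}"

lemma subspace_highest: "subspace (highest k)"
  unfolding subspace_def highest_def
  by (auto simp: E.add E.scale H.add H.scale scale_right_distrib scale_left_commute)

text \<open>Diagonalizes \<open>H\<close> on the kernel of \<open>E\<close>:
  \<open>(H - m) x\<close> lies in the next layer, spanned by weights above m, where
  \<open>H - m\<close> is invertible; subtracting the preimage from \<open>x\<close> leaves a vector
  of weight m.\<close>

lemma ker_E_inter_range:
  assumes nil: "\<And>x. (E ^^ N) x = 0" and "E x = 0" "x = (E ^^ m) w"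
  shows "x \<in> span (\<Union>k\<in>{m..}. highest k)"
proof -
  have "\<forall>x w. E x = 0 \<longrightarrow> x = (E ^^ m) w \<longrightarrow> x \<in> span (\<Union>k\<in>{m..}. highest k)" if "m \<le> N" for m
    using that
  proof (induction rule: inc_induct)
    case base
    show ?case using nil by (auto simp: span_zero)
  next
    case (step m)
    show ?case
    proof (intro allI impI)
      fix x w assume x: "E x = 0" and w: "x = (E ^^ m) w"
      define S where "S = span (\<Union>k\<in>{Suc m..}. highest k)"
      define z1 where "z1 = H x - scale (of_nat m) x"
      have "\<exists>w'. z1 = (E ^^ Suc m) w'"
        using ker_E_shift[of m w] x w by (metis z1_def)
      moreover have "E z1 = 0"
        using x by (simp add: z1_def E.diff E.scale E_H_ker)
      ultimately have "z1 \<in> S" using step.IH S_def by blast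
      then have "\<exists>z\<in>S. E z = 0 \<and> H z - scale (of_nat m) z = z1"
        unfolding S_def
      proof (induction z1 rule: span_inductI)
        case zero
        show ?case by (auto intro!: bexI[of _ 0] span_zero)
      next
        case (base y)
        then obtain k where k: "k \<ge> Suc m" "y \<in> highest k" by auto
        define c :: 'k where "c = of_nat k - of_nat m"
        have c: "c \<noteq> 0" using k(1) by (simp add: c_def)
        have "H y - scale (of_nat m) y = scale c y"
          using k by (simp add: highest_def c_def scale_left_diff_distrib)
        moreover have "H (scale (inverse c) y) - scale (of_nat m) (scale (inverse c) y)
            = scale (inverse c) (H y - scale (of_nat m) y)"
          by (simp add: H.scale scale_right_diff_distrib scale_left_commute)
        ultimately have "H (scale (inverse c) y) - scale (of_nat m) (scale (inverse c) y) = y"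
          using c by simp
        moreover have "E y = 0" using k by (simp add: highest_def)
        ultimately show ?case using base
          by (intro bexI[of _ "scale (inverse c) y"]) (auto simp: E.scale intro: span_base span_scale)
      next
        case (add y z)
        then obtain y' z' where "y' \<in> span (\<Union>k\<in>{Suc m..}. highest k)"
          "E y' = 0" "H y' - scale (of_nat m) y' = y" "z' \<in> span (\<Union>k\<in>{Suc m..}. highest k)"
          "E z' = 0" "H z' - scale (of_nat m) z' = z" by blast
        then show ?case
          by (intro bexI[of _ "y' + z'"]) (auto simp: E.add H.add scale_right_distrib span_add)
      next
        case (scale c y)
        then obtain y' where "y' \<in> span (\<Union>k\<in>{Suc m..}. highest k)"
          "E y' = 0" "H y' - scale (of_nat m) y' = y" by blast
        then show ?case
          by (intro bexI[of _ "scale c y'"])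
             (auto simp: E.scale H.scale scale_right_diff_distrib scale_left_commute span_scale)
      qed
      then obtain z where z: "z \<in> S" "E z = 0" "H z - scale (of_nat m) z = z1" by blast
      have "H (x - z) = scale (of_nat m) (x - z)"
        using z(3) by (simp add: z1_def H.diff scale_right_diff_distrib algebra_simps)
      then have "x - z \<in> highest m"
        using x z by (simp add: highest_def E.diff)
      then have "x - z \<in> span (\<Union>k\<in>{m..}. highest k)"
        by (intro span_base) auto
      moreover have "z \<in> span (\<Union>k\<in>{m..}. highest k)"
        using z(1) unfolding S_def by (rule span_mono[THEN subsetD, rotated]) force
      ultimately show "x \<in> span (\<Union>k\<in>{m..}. highest k)"
        using span_add by fastforce
    qed
  qed
  then show ?thesis
  proof (cases "m \<le> N")
    case False
    have "(E ^^ m) w = (E ^^ (m - N)) ((E ^^ N) w)"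
      using False by (simp flip: funpow_add comp_apply[of "E ^^ _" "E ^^ _"])
    also have "\<dots> = 0" by (simp add: nil)
    finally show ?thesis using assms span_zero by simp
  qed (use assms in blast)
qed

end

section \<open>Strings of highest weight vectors under the full sl(2) relations\<close>

locale sl2_nilpotent = raising_pair scale E H F
  for scale :: "'k::field_char_0 \<Rightarrow> 'v::ab_group_add \<Rightarrow> 'v" and E H F +
  fixes N :: nat
  assumes HF: "H (F x) = F (H x) - scale 2 (F x)"
    and pow_E_zero: "(E ^^ N) x = 0"
begin

lemma H_pow_F:
  assumes "H v = scale c v"
  shows "H ((F ^^ j) v) = scale (c - 2 * of_nat j) ((F ^^ j) v)"
proof (induction j)
  case (Suc j)
  have "H ((F ^^ Suc j) v) = F (H ((F ^^ j) v)) - scale 2 (F ((F ^^ j) v))"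
    by (simp add: HF)
  also have "\<dots> = scale (c - 2 * of_nat j - 2) ((F ^^ Suc j) v)"
    by (simp add: Suc F.scale flip: scale_left_diff_distrib)
  finally show ?case by (simp add: algebra_simps)
qed (simp add: assms)

lemma E_pow_F_highest:
  assumes "v \<in> highest k"
  shows "E ((F ^^ Suc j) v) = scale (of_nat (Suc j) * (of_nat k - of_nat j)) ((F ^^ j) v)"
proof (induction j)
  case 0
  show ?case using assms by (simp add: EF highest_def)
next
  case (Suc j)
  have "E ((F ^^ Suc (Suc j)) v) = F (E ((F ^^ Suc j) v)) + H ((F ^^ Suc j) v)"
    by (simp only: funpow.simps comp_apply EF)
  also have "F (E ((F ^^ Suc j) v)) = scale (of_nat (Suc j) * (of_nat k - of_nat j)) ((F ^^ Suc j) v)"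
    by (simp only: Suc F.scale) simp
  also have "H ((F ^^ Suc j) v) = scale (of_nat k - 2 * of_nat (Suc j)) ((F ^^ Suc j) v)"
    using assms by (intro H_pow_F) (simp add: highest_def)
  also have "scale (of_nat (Suc j) * (of_nat k - of_nat j)) ((F ^^ Suc j) v)
      + scale (of_nat k - 2 * of_nat (Suc j)) ((F ^^ Suc j) v)
      = scale (of_nat (Suc j) * (of_nat k - of_nat j) + (of_nat k - 2 * of_nat (Suc j)))
      ((F ^^ Suc j) v)" by (simp only: scale_left_distrib)
  also have "of_nat (Suc j) * (of_nat k - of_nat j) + (of_nat k - 2 * of_nat (Suc j))
      = of_nat (Suc (Suc j)) * (of_nat k - of_nat (Suc j) :: 'k)"
    by (simp add: algebra_simps mult_2)
  finally show ?case .
qed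

text \<open>The vector is killed by \<open>E\<close> and has weight \<open>- k - 2\<close>, which is
  not a natural number.\<close>

lemma pow_F_highest_zero:
  assumes "v \<in> highest k"
  shows "(F ^^ Suc k) v = 0"
proof (rule ker_E_weight_nat[OF pow_E_zero])
  show "E ((F ^^ Suc k) v) = 0" using E_pow_F_highest[OF assms, of k] by simp
  show "H ((F ^^ Suc k) v) = scale (of_nat k - 2 * of_nat (Suc k)) ((F ^^ Suc k) v)"
    using assms by (intro H_pow_F) (simp add: highest_def)
  show "of_nat k - 2 * of_nat (Suc k) \<noteq> (of_nat m :: 'k)" for m
  proof
    assume "of_nat k - 2 * of_nat (Suc k) = (of_nat m :: 'k)"
    moreover have "(of_nat (m + k + 2) :: 'k) = of_nat m - (of_nat k - 2 * of_nat (Suc k))"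
      by (simp add: algebra_simps)
    ultimately have "(of_nat (m + k + 2) :: 'k) = 0" by simp
    then show False by (simp only: of_nat_eq_0_iff)
  qed
qed

lemma pow_E_pow_F_highest:
  assumes "v \<in> highest k" "j \<le> k"
  shows "\<exists>c. c \<noteq> 0 \<and> (E ^^ j) ((F ^^ j) v) = scale c v"
  using assms(2)
proof (induction j)
  case 0
  show ?case by (auto intro!: exI[of _ 1])
next
  case (Suc j)
  then obtain c where c: "c \<noteq> 0" "(E ^^ j) ((F ^^ j) v) = scale c v" by auto
  interpret Ej: Vector_Spaces.linear scale scale "E ^^ j" by (intro linear_pow linE)
  have "(E ^^ Suc j) ((F ^^ Suc j) v) = (E ^^ j) (E ((F ^^ Suc j) v))"
    by (simp only: funpow_Suc_right comp_apply)
  also have "\<dots> = scale (of_nat (Suc j) * (of_nat k - of_nat j)) (scale c v)"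
    by (simp only: E_pow_F_highest[OF assms(1)] Ej.scale c)
  finally show ?case
    using c Suc.prems by (intro exI[of _ "of_nat (Suc j) * (of_nat k - of_nat j) * c"]) (auto simp del: of_nat_Suc)
qed

lemma pow_F_highest_nonzero:
  assumes "v \<in> highest k" "v \<noteq> 0" "j \<le> k"
  shows "(F ^^ j) v \<noteq> 0"
proof
  assume "(F ^^ j) v = 0"
  then show False using pow_E_pow_F_highest[of v k j] assms by auto
qed

text \<open>Stands in for complete reducibility; only spanning is obtained, which suffices because a
  nondegenerate form later detects vectors. Induct on the power of \<open>E\<close> killing
  \<open>x\<close>: \<open>E^j x\<close> is a sum of highest weight vectors of weight at least j,
  each a multiple of some \<open>E^j F^j v\<close>, so subtracting an element of \<open>M\<close>
  lowers the power.\<close>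

lemma span_strings: "span {(F ^^ j) v | j v k. v \<in> highest k \<and> j \<le> k} = UNIV"
proof -
  define M where "M = span {(F ^^ j) v | j v k. v \<in> highest k \<and> j \<le> k}"
  have "\<forall>x. (E ^^ j) x = 0 \<longrightarrow> x \<in> M" for j
  proof (induction j)
    case 0
    show ?case by (simp add: M_def span_zero)
  next
    case (Suc j)
    show ?case
    proof (intro allI impI)
      fix x assume x: "(E ^^ Suc j) x = 0"
      interpret Ej: Vector_Spaces.linear scale scale "E ^^ j" by (intro linear_pow linE)
      have "(E ^^ j) x \<in> span (\<Union>k\<in>{j..}. highest k)"
        using ker_E_inter_range[OF pow_E_zero] x by auto
      moreover have "\<exists>y\<in>M. (E ^^ j) y = w" if "w \<in> span (\<Union>k\<in>{j..}. highest k)" for w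
        using that unfolding M_def
      proof (induction w rule: span_inductI)
        case zero
        show ?case by (auto intro!: bexI[of _ 0] span_zero)
      next
        case (base y)
        then obtain k where k: "k \<ge> j" "y \<in> highest k" by auto
        obtain c where c: "c \<noteq> 0" "(E ^^ j) ((F ^^ j) y) = scale c y"
          using pow_E_pow_F_highest k by blast
        show ?case
          using c k by (intro bexI[of _ "scale (inverse c) ((F ^^ j) y)"] span_scale span_base)
            (auto simp: Ej.scale)
      next
        case (add y z)
        then obtain y' z' where "y' \<in> span {(F ^^ j) v | j v k. v \<in> highest k \<and> j \<le> k}"
          "(E ^^ j) y' = y" "z' \<in> span {(F ^^ j) v | j v k. v \<in> highest k \<and> j \<le> k}"
          "(E ^^ j) z' = z" by blast
        then show ?case by (intro bexI[of _ "y' + z'"] span_add) (simp_all add: Ej.add)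
      next
        case (scale c y)
        then obtain y' where "y' \<in> span {(F ^^ j) v | j v k. v \<in> highest k \<and> j \<le> k}"
          "(E ^^ j) y' = y" by blast
        then show ?case by (intro bexI[of _ "scale c y'"] span_scale) (simp_all add: Ej.scale)
      qed
      ultimately obtain y where y: "y \<in> M" "(E ^^ j) y = (E ^^ j) x" by blast
      then have "(E ^^ j) (x - y) = 0" by (simp add: Ej.diff)
      then have "x - y + y \<in> M"
        using Suc.IH y(1) y unfolding M_def by (intro span_add) blast+
      then show "x \<in> M" by simp
    qed
  qed
  then show ?thesis using pow_E_zero M_def by blast
qed

text \<open>The same exponent works because \<open>E^N F^N v\<close> would be a nonzero multiple of
  \<open>v\<close> on a string with \<open>N \<le> k\<close>. This lets \<open>E\<close> and
  \<open>F\<close> exchange roles afterwards.\<close>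

lemma pow_F_zero: "(F ^^ N) x = 0"
proof -
  have "x \<in> span {(F ^^ j) v | j v k. v \<in> highest k \<and> j \<le> k}" using span_strings by blast
  interpret FN: Vector_Spaces.linear scale scale "F ^^ N" by (intro linear_pow linF)
  from \<open>x \<in> span _\<close> show ?thesis
  proof (induction x rule: span_inductI)
    case (base y)
    then obtain j v k where y: "y = (F ^^ j) v" "v \<in> highest k" by blast
    show ?case
    proof (cases "v = 0")
      case True
      then show ?thesis using y by simp
    next
      case False
      have "k < N"
      proof (rule ccontr)
        assume "\<not> k < N"
        then have kN: "N \<le> k" by simp
        obtain c where "c \<noteq> 0" "(E ^^ N) ((F ^^ N) v) = scale c v"
          using pow_E_pow_F_highest[OF y(2) kN] by blast
        then show False using pow_E_zero False by simp
      qed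
      then obtain i where "N + j = i + Suc k"
        by (intro that[of "N + j - Suc k"]) simp
      then have "(F ^^ N) y = (F ^^ i) ((F ^^ Suc k) v)"
        unfolding y by (metis comp_apply funpow_add)
      also have "\<dots> = 0" by (simp only: pow_F_highest_zero[OF y(2)] pow_F_0)
      finally show ?thesis .
    qed
  qed (auto simp: FN.add FN.scale)
qed

end

subsection \<open>Nilpotent operators\<close>

lemma vector_space_field: "vector_space ((*) :: 'k::field \<Rightarrow> 'k \<Rightarrow> 'k)"
  by unfold_locales (simp_all add: algebra_simps)

lemma (in vector_space) linear_functional_nonzero:
  assumes "v \<noteq> 0"
  shows "\<exists>\<phi>. Vector_Spaces.linear scale (*) \<phi> \<and> \<phi> v = 1"
proof -
  interpret vector_space_pair scale "(*)"
    by (intro vector_space_pair.intro vector_space_axioms vector_space_field)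
  show ?thesis
    using linear_independent_extend[of "{v}" "\<lambda>_. 1"] assms by auto
qed

text \<open>Makes the functionals \<open>\<phi> \<circ> e^j\<close> dual to the reversed string of
  \<open>c\<close>. Each correction \<open>\<phi> - a (\<phi> \<circ> e^(k+1))\<close> fixes one
  more value and leaves those settled before alone, since there \<open>e^(k+1)\<close> runs past the
  end of the string.\<close>

lemma (in vector_space) linear_functional_string:
  assumes lin: "Vector_Spaces.linear scale scale e"
    and top: "(e ^^ m) c \<noteq> 0" "(e ^^ Suc m) c = 0"
  shows "\<exists>\<phi>. Vector_Spaces.linear scale (*) \<phi> \<and> \<phi> ((e ^^ m) c) = 1 \<and> (\<forall>j<m. \<phi> ((e ^^ j) c) = 0)"
proof -
  interpret e: Vector_Spaces.linear scale scale e by (rule lin)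
  have zero: "(e ^^ j) c = 0" if "j > m" for j
  proof -
    have "(e ^^ j) c = (e ^^ (j - Suc m)) ((e ^^ Suc m) c)"
      using that by (simp del: funpow.simps flip: funpow_add comp_apply[of "e ^^ _" "e ^^ _"])
    also have "\<dots> = 0"
      unfolding top by (rule module_hom.zero[of scale scale]) (use linear_pow[OF lin] in \<open>simp add: module_hom_iff_linear\<close>)
    finally show ?thesis .
  qed
  have "\<exists>\<phi>. Vector_Spaces.linear scale (*) \<phi> \<and> \<phi> ((e ^^ m) c) = 1 \<and>
      (\<forall>i. 1 \<le> i \<and> i \<le> k \<longrightarrow> \<phi> ((e ^^ (m - i)) c) = 0)" if "k \<le> m" for k
    using that
  proof (induction k)
    case 0
    then show ?case using linear_functional_nonzero[OF top(1)] by auto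
  next
    case (Suc k)
    then obtain \<phi> where \<phi>: "Vector_Spaces.linear scale (*) \<phi>" "\<phi> ((e ^^ m) c) = 1"
      "\<And>i. 1 \<le> i \<Longrightarrow> i \<le> k \<Longrightarrow> \<phi> ((e ^^ (m - i)) c) = 0" by auto
    interpret \<phi>: Vector_Spaces.linear scale "(*)" \<phi> by (rule \<phi>)
    interpret ek: Vector_Spaces.linear scale scale "e ^^ Suc k" by (intro linear_pow lin)
    define a where "a = \<phi> ((e ^^ (m - Suc k)) c)"
    define \<psi> where "\<psi> = (\<lambda>x. \<phi> x - a * \<phi> ((e ^^ Suc k) x))"
    have comp: "(e ^^ Suc k) ((e ^^ (m - i)) c) = (e ^^ (Suc k + (m - i))) c" for i
      by (simp only: funpow_add comp_apply)
    have "Vector_Spaces.linear scale (*) \<psi>"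
      unfolding Vector_Spaces.linear_iff
      by (simp only: vector_space_axioms vector_space_field \<psi>_def ek.add ek.scale \<phi>.add \<phi>.scale
          distrib_left right_diff_distrib mult.left_commute) simp
    moreover have "\<psi> ((e ^^ m) c) = 1"
      using comp[of 0] zero[of "Suc k + m"] by (simp add: \<psi>_def \<phi>)
    moreover have "\<psi> ((e ^^ (m - i)) c) = 0" if i: "1 \<le> i" "i \<le> Suc k" for i
    proof (cases "i = Suc k")
      case True
      then have "(e ^^ Suc k) ((e ^^ (m - i)) c) = (e ^^ m) c"
        using comp[of i] Suc.prems by simp
      then show ?thesis using True \<phi>(2) by (simp only: \<psi>_def a_def) simp
    next
      case False
      then have "(e ^^ Suc k) ((e ^^ (m - i)) c) = 0"
        unfolding comp using i Suc.prems by (intro zero) simp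
      then show ?thesis using \<phi>(3)[of i] i False by (simp only: \<psi>_def) simp
    qed
    ultimately show ?case by blast
  qed
  from this[of m] obtain \<phi> where \<phi>: "Vector_Spaces.linear scale (*) \<phi>" "\<phi> ((e ^^ m) c) = 1"
    "\<And>i. 1 \<le> i \<Longrightarrow> i \<le> m \<Longrightarrow> \<phi> ((e ^^ (m - i)) c) = 0" by auto
  have "\<phi> ((e ^^ j) c) = 0" if "j < m" for j
    using \<phi>(3)[of "m - j"] that by simp
  then show ?thesis using \<phi> by blast
qed

text \<open>The computation behind the sl(2) coefficients on a string: \<open>\<kappa>\<close> is
  quadratic with second difference -2 and vanishes at -1 and m, which lets the shifted sums keep the
  same range.\<close>

lemma (in vector_space) string_double_commutator:
  fixes \<kappa> :: "'a \<Rightarrow> 'a" and a :: "nat \<Rightarrow> 'a" and b :: "nat \<Rightarrow> 'b" and m :: nat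
  defines "\<kappa> \<equiv> (\<lambda>t. (of_nat m - t) * (t + 1))"
  assumes a: "a (Suc m) = 0" and b: "b (Suc m) = 0"
  shows "scale 2 (\<Sum>j<m. scale (\<kappa> (of_nat j) * a (Suc j)) (b (m - j)))
     - (\<Sum>j<m. scale (\<kappa> (of_nat j) * a (Suc (Suc j))) (b (m - Suc j)))
     - (\<Sum>j<m. scale (\<kappa> (of_nat j) * a j) (b (Suc (m - j))))
     = scale 2 (\<Sum>j<m. scale (a (Suc j)) (b (m - j)))"
proof (cases m)
  case (Suc p)
  have "(\<Sum>j<m. scale (\<kappa> (of_nat j) * a (Suc (Suc j))) (b (m - Suc j)))
      = (\<Sum>j<p. scale (\<kappa> (of_nat j) * a (Suc (Suc j))) (b (m - Suc j)))"
    using a by (simp add: Suc)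
  also have "\<dots> = (\<Sum>j<p. scale (\<kappa> (of_nat (Suc j) - 1) * a (Suc (Suc j))) (b (m - Suc j)))"
    by simp
  also have "\<dots> = (\<Sum>j<m. scale (\<kappa> (of_nat j - 1) * a (Suc j)) (b (m - j)))"
    unfolding Suc sum.lessThan_Suc_shift by (simp add: \<kappa>_def)
  finally have 1: "(\<Sum>j<m. scale (\<kappa> (of_nat j) * a (Suc (Suc j))) (b (m - Suc j)))
      = (\<Sum>j<m. scale (\<kappa> (of_nat j - 1) * a (Suc j)) (b (m - j)))" .
  have "(\<Sum>j<m. scale (\<kappa> (of_nat j) * a j) (b (Suc (m - j))))
      = (\<Sum>j<p. scale (\<kappa> (of_nat (Suc j)) * a (Suc j)) (b (Suc (m - Suc j))))"
    unfolding Suc sum.lessThan_Suc_shift using b by (simp add: Suc)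
  also have "\<dots> = (\<Sum>j<p. scale (\<kappa> (of_nat j + 1) * a (Suc j)) (b (m - j)))"
    by (intro sum.cong) (auto simp: Suc Suc_diff_le add.commute)
  also have "\<dots> = (\<Sum>j<m. scale (\<kappa> (of_nat j + 1) * a (Suc j)) (b (m - j)))"
    unfolding Suc by (simp add: \<kappa>_def Suc)
  finally have 2: "(\<Sum>j<m. scale (\<kappa> (of_nat j) * a j) (b (Suc (m - j))))
      = (\<Sum>j<m. scale (\<kappa> (of_nat j + 1) * a (Suc j)) (b (m - j)))" .
  have \<kappa>: "2 * \<kappa> t - \<kappa> (t - 1) - \<kappa> (t + 1) = 2" for t
    by (simp add: \<kappa>_def algebra_simps)
  have "scale 2 (\<Sum>j<m. scale (\<kappa> (of_nat j) * a (Suc j)) (b (m - j)))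
      - (\<Sum>j<m. scale (\<kappa> (of_nat j - 1) * a (Suc j)) (b (m - j)))
      - (\<Sum>j<m. scale (\<kappa> (of_nat j + 1) * a (Suc j)) (b (m - j)))
      = (\<Sum>j<m. scale ((2 * \<kappa> (of_nat j) - \<kappa> (of_nat j - 1) - \<kappa> (of_nat j + 1)) * a (Suc j)) (b (m - j)))"
    by (simp only: scale_sum_right scale_scale sum_subtractf scale_left_diff_distrib left_diff_distrib mult.assoc)
  then show ?thesis
    unfolding 1 2 \<kappa> by (simp add: scale_sum_right)
qed simp

text \<open>
  Splits off one Jordan string of maximal length on \<open>S\<close>. The complement is cut out by the
  functionals \<open>\<phi> \<circ> e\<^sup>j\<close>, hence \<open>e\<close>-stable; on the string \<open>f\<close> has the weights \<open>i(m + 1 - i)\<close> of the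
  simple \<open>sl\<^sub>2\<close>-module.
\<close>

lemma (in finite_dimensional_vector_space) nilpotent_double_commutator:
  assumes lin: "Vector_Spaces.linear scale scale e"
    and S: "subspace S" "\<And>x. x \<in> S \<Longrightarrow> e x \<in> S" "\<And>x. x \<in> S \<Longrightarrow> (e ^^ N) x = 0"
  shows "\<exists>f. Vector_Spaces.linear scale scale f \<and>
    (\<forall>x\<in>S. scale 2 (e (f (e x))) - f (e (e x)) - e (e (f x)) = scale 2 (e x))"
  using S
proof (induction "dim S" arbitrary: S rule: less_induct)
  case less
  interpret e: Vector_Spaces.linear scale scale e by (rule lin)
  define n where "n = (LEAST n. \<forall>x\<in>S. (e ^^ n) x = 0)"
  have n: "\<forall>x\<in>S. (e ^^ n) x = 0"
    unfolding n_def by (rule LeastI[of _ N]) (use less.prems(3) in blast)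
  show ?case
  proof (cases n)
    case 0
    then have "S \<subseteq> {0}" using n by auto
    then show ?thesis
      by (intro exI[of _ "\<lambda>_. 0"]) (auto simp: Vector_Spaces.linear_iff vector_space_axioms)
  next
    case (Suc m)
    then have "\<not> (\<forall>x\<in>S. (e ^^ m) x = 0)"
      using not_less_Least[of m "\<lambda>n. \<forall>x\<in>S. (e ^^ n) x = 0"] unfolding n_def by simp
    then obtain c where c: "c \<in> S" "(e ^^ m) c \<noteq> 0" by blast
    obtain \<phi> where \<phi>: "Vector_Spaces.linear scale (*) \<phi>" "\<phi> ((e ^^ m) c) = 1"
      "\<And>j. j < m \<Longrightarrow> \<phi> ((e ^^ j) c) = 0"
      using linear_functional_string[OF lin c(2)] n c Suc by auto
    interpret \<phi>: Vector_Spaces.linear scale "(*)" \<phi> by (rule \<phi>)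
    have pow_e_0 [simp]: "(e ^^ j) 0 = 0" for j by (induction j) auto
    have pow_S: "(e ^^ j) x \<in> S" if "x \<in> S" for x j
      using that less.prems(2) by (induction j) auto
    have zero: "(e ^^ j) x = 0" if "j > m" "x \<in> S" for j x
    proof -
      have "(e ^^ j) x = (e ^^ (j - Suc m)) ((e ^^ Suc m) x)"
        using that by (simp del: funpow.simps flip: funpow_add comp_apply[of "e ^^ _" "e ^^ _"])
      then show ?thesis using n that Suc by simp
    qed
    have lin_pow: "Vector_Spaces.linear scale scale (e ^^ j)" for j by (intro linear_pow lin)
    have lin_coeff: "\<phi> ((e ^^ j) (x + y)) = \<phi> ((e ^^ j) x) + \<phi> ((e ^^ j) y)"
      "\<phi> ((e ^^ j) (scale r x)) = r * \<phi> ((e ^^ j) x)"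
      "\<phi> ((e ^^ j) (x - y)) = \<phi> ((e ^^ j) x) - \<phi> ((e ^^ j) y)" for j x y r
    proof -
      interpret ej: Vector_Spaces.linear scale scale "e ^^ j" by (rule lin_pow)
      show "\<phi> ((e ^^ j) (x + y)) = \<phi> ((e ^^ j) x) + \<phi> ((e ^^ j) y)"
        "\<phi> ((e ^^ j) (scale r x)) = r * \<phi> ((e ^^ j) x)"
        "\<phi> ((e ^^ j) (x - y)) = \<phi> ((e ^^ j) x) - \<phi> ((e ^^ j) y)"
        by (simp_all add: ej.add ej.scale ej.diff \<phi>.add \<phi>.scale \<phi>.diff)
    qed
    \<comment> \<open>On \<open>S\<close> this is the projection onto the string along
      \<open>S'\<close>: by the choice of \<open>\<phi>\<close>, the value of \<open>\<phi>\<close>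
      at \<open>e^i (e^(m-j) c)\<close> is 1 for \<open>i = j\<close> and 0 otherwise, for i and j
      up to m.\<close>
    define P where "P x = (\<Sum>j<Suc m. scale (\<phi> ((e ^^ j) x)) ((e ^^ (m - j)) c))" for x
    define \<kappa> :: "'a \<Rightarrow> 'a" where "\<kappa> t = (of_nat m - t) * (t + 1)" for t
    define g where "g x = (\<Sum>j<m. scale (\<kappa> (of_nat j) * \<phi> ((e ^^ j) x)) ((e ^^ (m - Suc j)) c))" for x
    have lin_g: "Vector_Spaces.linear scale scale g"
      unfolding Vector_Spaces.linear_iff g_def lin_coeff
      by (simp only: vector_space_axioms distrib_left scale_left_distrib sum.distrib scale_sum_right
          scale_scale mult.left_commute) simp
    have lin_P: "Vector_Spaces.linear scale scale P"
      unfolding Vector_Spaces.linear_iff P_def lin_coeff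
      by (simp only: vector_space_axioms scale_sum_right scale_left_distrib sum.distrib scale_scale) simp
    interpret P: Vector_Spaces.linear scale scale P by (rule lin_P)
    define S' where "S' = {x \<in> S. \<forall>j\<le>m. \<phi> ((e ^^ j) x) = 0}"
    have P_S: "P x \<in> S" for x
      unfolding P_def using less.prems(1) pow_S[OF c(1)]
      by (intro subspace_sum subspace_scale) auto
    have coeff_P: "\<phi> ((e ^^ i) (P x)) = \<phi> ((e ^^ i) x)" if "i \<le> m" for i x
    proof -
      interpret ei: Vector_Spaces.linear scale scale "e ^^ i" by (rule lin_pow)
      have "\<phi> ((e ^^ i) (P x)) = (\<Sum>j<Suc m. \<phi> ((e ^^ j) x) * \<phi> ((e ^^ (i + (m - j))) c))"
        unfolding P_def ei.sum ei.scale \<phi>.sum \<phi>.scale by (simp only: funpow_add comp_apply)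
      also have "\<dots> = (\<Sum>j<Suc m. if j = i then \<phi> ((e ^^ i) x) else 0)"
      proof (intro sum.cong refl)
        fix j assume j: "j \<in> {..<Suc m}"
        consider "j = i" | "j < i" | "i < j" by linarith
        then show "\<phi> ((e ^^ j) x) * \<phi> ((e ^^ (i + (m - j))) c) = (if j = i then \<phi> ((e ^^ i) x) else 0)"
        proof cases
          case 1
          then show ?thesis using that \<phi>(2) by simp
        next
          case 2
          then have "(e ^^ (i + (m - j))) c = 0" using j by (intro zero c) auto
          then show ?thesis using 2 by simp
        next
          case 3
          then show ?thesis using j \<phi>(3)[of "i + (m - j)"] by simp
        qed
      qed
      also have "\<dots> = \<phi> ((e ^^ i) x)" using that by simp
      finally show ?thesis .
    qed
    have Q_S': "x - P x \<in> S'" if "x \<in> S" for x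
      using that P_S less.prems(1) by (auto simp: S'_def lin_coeff coeff_P subspace_diff)
    have eP: "e (P x) = (\<Sum>j<m. scale (\<phi> ((e ^^ Suc j) x)) ((e ^^ (m - j)) c))" for x
    proof -
      have "e (P x) = (\<Sum>j<Suc m. scale (\<phi> ((e ^^ j) x)) ((e ^^ Suc (m - j)) c))"
        unfolding P_def by (simp only: e.sum e.scale funpow.simps comp_apply)
      also have "\<dots> = (\<Sum>j<m. scale (\<phi> ((e ^^ Suc j) x)) ((e ^^ Suc (m - Suc j)) c))"
        unfolding sum.lessThan_Suc_shift using zero[OF _ c(1), of "Suc m"] by simp
      also have "\<dots> = (\<Sum>j<m. scale (\<phi> ((e ^^ Suc j) x)) ((e ^^ (m - j)) c))"
        by (intro sum.cong) (auto simp: Suc_diff_Suc simp del: funpow.simps)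
      finally show ?thesis .
    qed
    have Pe: "P (e x) = e (P x)" if "x \<in> S" for x
    proof -
      have "P (e x) = (\<Sum>j<Suc m. scale (\<phi> ((e ^^ Suc j) x)) ((e ^^ (m - j)) c))"
        unfolding P_def by (simp only: funpow_Suc_right comp_apply)
      also have "\<dots> = e (P x)"
        unfolding eP sum.lessThan_Suc using zero[OF _ that, of "Suc m"] by (simp del: funpow.simps)
      finally show ?thesis .
    qed
    have g: "scale 2 (e (g (e x))) - g (e (e x)) - e (e (g x)) = scale 2 (e (P x))" if "x \<in> S" for x
    proof -
      have "e (g (e x)) = (\<Sum>j<m. scale (\<kappa> (of_nat j) * \<phi> ((e ^^ Suc j) x)) ((e ^^ Suc (m - Suc j)) c))"
        unfolding g_def by (simp only: e.sum e.scale funpow_Suc_right comp_apply funpow_swap1)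
      also have "\<dots> = (\<Sum>j<m. scale (\<kappa> (of_nat j) * \<phi> ((e ^^ Suc j) x)) ((e ^^ (m - j)) c))"
        by (intro sum.cong) (auto simp: Suc_diff_Suc simp del: funpow.simps)
      finally have 1: "e (g (e x)) = \<dots>" .
      have 2: "g (e (e x)) = (\<Sum>j<m. scale (\<kappa> (of_nat j) * \<phi> ((e ^^ Suc (Suc j)) x)) ((e ^^ (m - Suc j)) c))"
        unfolding g_def by (simp only: funpow_Suc_right comp_apply)
      have "e (e (g x)) = (\<Sum>j<m. scale (\<kappa> (of_nat j) * \<phi> ((e ^^ j) x)) ((e ^^ Suc (Suc (m - Suc j))) c))"
        unfolding g_def by (simp only: e.sum e.scale funpow.simps comp_apply)
      also have "\<dots> = (\<Sum>j<m. scale (\<kappa> (of_nat j) * \<phi> ((e ^^ j) x)) ((e ^^ Suc (m - j)) c))"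
        by (intro sum.cong) (auto simp: Suc_diff_Suc simp del: funpow.simps)
      finally have 3: "e (e (g x)) = \<dots>" .
      show ?thesis
        unfolding 1 2 3 eP \<kappa>_def
        using zero[OF _ that, of "Suc m"] zero[OF _ c(1), of "Suc m"]
        by (intro string_double_commutator[where b = "\<lambda>i. (e ^^ i) c" and a = "\<lambda>i. \<phi> ((e ^^ i) x)"])
           (simp_all del: funpow.simps)
    qed
    have "c \<notin> S'" using \<phi>(2) by (auto simp: S'_def)
    have sub_S': "subspace S'"
      using less.prems(1) unfolding subspace_def S'_def by (auto simp: lin_coeff)
    moreover have "S' \<subset> S" using \<open>c \<notin> S'\<close> c(1) by (auto simp: S'_def)
    ultimately have "dim S' < dim S"
      using less.prems(1) by (intro dim_psubset) (simp add: span_eq_iff[THEN iffD2])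
    moreover have "e x \<in> S'" if "x \<in> S'" for x
    proof -
      have "\<phi> ((e ^^ j) (e x)) = 0" if "j \<le> m" for j
      proof (cases "j = m")
        case True
        then have "(e ^^ j) (e x) = 0" using zero[of "Suc m" x] \<open>x \<in> S'\<close> S'_def
          by (simp del: funpow.simps add: funpow_Suc_right)
        then show ?thesis by simp
      next
        case False
        then have "\<phi> ((e ^^ Suc j) x) = 0"
          using \<open>x \<in> S'\<close> that unfolding S'_def by (simp del: funpow.simps)
        then show ?thesis by (simp only: funpow_Suc_right comp_apply)
      qed
      then show ?thesis using that less.prems(2) by (auto simp: S'_def)
    qed
    moreover have "(e ^^ N) x = 0" if "x \<in> S'" for x
      using that less.prems(3) by (auto simp: S'_def)
    ultimately obtain f where f: "Vector_Spaces.linear scale scale f"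
      "\<And>x. x \<in> S' \<Longrightarrow> scale 2 (e (f (e x))) - f (e (e x)) - e (e (f x)) = scale 2 (e x)"
      using less.hyps[of S'] sub_S' by blast
    interpret f: Vector_Spaces.linear scale scale f by (rule f)
    interpret g: Vector_Spaces.linear scale scale g by (rule lin_g)
    \<comment> \<open>\<open>g\<close> vanishes on \<open>S'\<close> and solves the equation on the
      string; the inductive \<open>f\<close> is fed only the component in \<open>S'\<close>.\<close>
    define F where "F x = g x + f (x - P x)" for x
    have "Vector_Spaces.linear scale scale F"
      unfolding Vector_Spaces.linear_iff F_def
      by (simp add: vector_space_axioms g.add g.scale f.add f.scale f.diff P.add P.scale algebra_simps)
    moreover have "scale 2 (e (F (e x))) - F (e (e x)) - e (e (F x)) = scale 2 (e x)" if "x \<in> S" for x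
    proof -
      define y where "y = x - P x"
      have y: "e x - P (e x) = e y" "e (e x) - P (e (e x)) = e (e y)"
        using that less.prems(2) by (simp_all add: y_def Pe e.diff)
      have "scale 2 (e (F (e x))) - F (e (e x)) - e (e (F x))
          = (scale 2 (e (g (e x))) - g (e (e x)) - e (e (g x)))
          + (scale 2 (e (f (e y))) - f (e (e y)) - e (e (f y)))"
        unfolding F_def y by (simp add: e.add scale_right_distrib flip: y_def)
      also have "\<dots> = scale 2 (e (P x)) + scale 2 (e y)"
        using g[OF that] f(2)[OF Q_S'[OF that]] by (simp only: y_def)
      also have "\<dots> = scale 2 (e x)" by (simp add: y_def e.diff flip: scale_right_distrib)
      finally show ?thesis .
    qed
    ultimately show ?thesis by blast
  qed
qed

subsection \<open>Normal triples\<close>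

locale polarized_space = finite_dimensional_vector_space scale Basis
  for scale :: "'k::field_char_0 \<Rightarrow> 'v::ab_group_add \<Rightarrow> 'v" and Basis :: "'v set" +
  fixes \<Phi> :: "'v \<Rightarrow> 'v \<Rightarrow> 'k" and J :: "'v \<Rightarrow> 'v" and \<epsilon> :: 'k
  assumes lin_right: "Vector_Spaces.linear scale (*) (\<Phi> u)"
    and lin_left: "Vector_Spaces.linear scale (*) (\<lambda>u. \<Phi> u v)"
    and nondeg: "(\<And>u. \<Phi> u v = 0) \<Longrightarrow> v = 0"
    and form_sym: "\<Phi> u v = \<epsilon> * \<Phi> v u"
    and eps_square: "\<epsilon> * \<epsilon> = 1"
    and lin_J: "Vector_Spaces.linear scale scale J"
    and form_J: "\<Phi> (J u) (J v) = \<Phi> u v"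
    and J_J: "J (J v) = scale (- \<epsilon>) v"
begin

sublocale J: Vector_Spaces.linear scale scale J by (rule lin_J)
sublocale \<Phi>: Vector_Spaces.linear scale "(*)" "\<Phi> u" for u by (rule lin_right)
sublocale \<Phi>': Vector_Spaces.linear scale "(*)" "\<lambda>u. \<Phi> u v" for v by (rule lin_left)

lemma eps_cancel [simp]: "\<epsilon> * (\<epsilon> * x) = x"
  by (simp add: eps_square flip: mult.assoc)

lemma scale_half_double: "scale (1/2) (x + x) = x"
  by (simp flip: scale_2)

lemma form_eqI: "(\<And>u. \<Phi> u v = \<Phi> u w) \<Longrightarrow> v = w"
  using nondeg[of "v - w"] by (simp add: \<Phi>.diff)

text \<open>The adjoint of \<open>J\<close> is its inverse, which is
  \<open>- \<epsilon> J\<close>.\<close>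

lemma form_J_left: "\<Phi> (J u) v = - (\<epsilon> * \<Phi> u (J v))"
proof -
  have "\<Phi> u (J v) = - (\<epsilon> * \<Phi> (J u) v)"
    using form_J[of u "J v"] by (simp add: J_J \<Phi>.scale \<Phi>.neg)
  then show ?thesis by (simp only: mult_minus_right eps_cancel minus_minus)
qed

text \<open>\<open>T\<close> reads the values of the functional
  \<open>\<lambda>x. \<Phi> x u\<close> on \<open>Basis\<close> as coordinates, which turns the map
  from vectors to functionals into an endomorphism of V; nondegeneracy makes it injective, and
  finite dimension then surjective.\<close>

lemma riesz:
  assumes "Vector_Spaces.linear scale (*) \<phi>"
  shows "\<exists>u. \<forall>x. \<phi> x = \<Phi> x u"
proof -
  interpret \<phi>: Vector_Spaces.linear scale "(*)" \<phi> by (rule assms)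
  define T where "T u = (\<Sum>b\<in>Basis. scale (\<Phi> b u) b)" for u
  have T: "Vector_Spaces.linear scale scale T"
    unfolding Vector_Spaces.linear_iff T_def
    by (simp only: vector_space_axioms \<Phi>.add \<Phi>.scale scale_left_distrib sum.distrib
        scale_sum_right scale_scale) simp
  have coeff: "f b = g b"
    if eq: "(\<Sum>b\<in>Basis. scale (f b) b) = (\<Sum>b\<in>Basis. scale (g b) b)" and b: "b \<in> Basis" for f g b
  proof -
    have "(\<Sum>b\<in>Basis. scale (f b - g b) b) = 0"
      using eq by (simp add: scale_left_diff_distrib sum_subtractf)
    then have "f b - g b = 0"
      by (rule independentD[OF independent_Basis finite_Basis order_refl _ b])
    then show ?thesis by simp
  qed
  have Basis_eq: "\<phi>' x = \<psi> x"
    if "Vector_Spaces.linear scale (*) \<phi>'" "Vector_Spaces.linear scale (*) \<psi>"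
      "\<And>b. b \<in> Basis \<Longrightarrow> \<phi>' b = \<psi> b" for \<phi>' \<psi> x
  proof -
    interpret vector_space_pair scale "(*)"
      by (intro vector_space_pair.intro vector_space_axioms vector_space_field)
    show ?thesis using linear_eq_on[OF that(1,2), of x Basis] that(3) span_Basis by blast
  qed
  have "inj T"
  proof (rule injI)
    fix u v assume "T u = T v"
    then have "\<Phi> b u = \<Phi> b v" if "b \<in> Basis" for b
      using coeff[of "\<lambda>b. \<Phi> b u" "\<lambda>b. \<Phi> b v"] that unfolding T_def by blast
    then have "\<Phi> x u = \<Phi> x v" for x
      by (rule Basis_eq[OF lin_left lin_left])
    then show "u = v" by (rule form_eqI)
  qed
  then obtain u where u: "T u = (\<Sum>b\<in>Basis. scale (\<phi> b) b)"
    using linear_inj_imp_surj[OF T] by (metis surjD)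
  have "\<phi> x = \<Phi> x u" for x
  proof (rule Basis_eq[OF assms lin_left])
    show "\<phi> b = \<Phi> b u" if "b \<in> Basis" for b
      using coeff[OF _ that, of \<phi> "\<lambda>b. \<Phi> b u"] u unfolding T_def by simp
  qed
  then show ?thesis by blast
qed

lemma adjoint_exists:
  assumes "Vector_Spaces.linear scale scale f"
  shows "\<exists>g. Vector_Spaces.linear scale scale g \<and> (\<forall>u v. \<Phi> (f u) v = \<Phi> u (g v))"
proof -
  interpret f: Vector_Spaces.linear scale scale f by (rule assms)
  have "\<exists>w. \<forall>u. \<Phi> (f u) v = \<Phi> u w" for v
    by (rule riesz) (simp add: Vector_Spaces.linear_iff vector_space_axioms vector_space_field
        f.add f.scale \<Phi>'.add \<Phi>'.scale)
  then obtain g where g: "\<And>u v. \<Phi> (f u) v = \<Phi> u (g v)" by metis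
  have "g (x + y) = g x + g y" "g (scale c x) = scale c (g x)" for x y c
    by (rule form_eqI, simp add: \<Phi>.add \<Phi>.scale flip: g)+
  then show ?thesis
    using g by (intro exI[of _ g]) (simp add: Vector_Spaces.linear_iff vector_space_axioms)
qed

lemma inv_J: "inv J v = scale (- \<epsilon>) (J v)"
proof (rule inv_f_eq)
  show "inj J"
    by (rule injI) (metis J_J scale_cancel_left eps_square mult_zero_left neg_equal_0_iff_equal zero_neq_one)
  show "J (scale (- \<epsilon>) (J v)) = v"
    by (simp add: J.neg J.scale J_J eps_square)
qed

lemma theta_eq: "Vector_Spaces.linear scale scale x \<Longrightarrow> theta J x v = scale (- \<epsilon>) (J (x (J v)))"
  unfolding theta_def comp_def inv_J
  by (metis J.scale module_hom.scale module_hom_iff_linear)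

lemma J_theta: "Vector_Spaces.linear scale scale x \<Longrightarrow> theta J x (J v) = J (x v)"
proof -
  assume x: "Vector_Spaces.linear scale scale x"
  then interpret x: Vector_Spaces.linear scale scale x .
  show ?thesis by (simp add: theta_eq[OF x] J_J x.neg x.scale J.neg J.scale eps_square)
qed

lemma surj_J: "\<exists>w. v = J w"
  using J_J[of "scale (- \<epsilon>) v"] eps_square by (intro exI[of _ "J (scale (- \<epsilon>) v)"]) simp

text \<open>Conjugation by \<open>J\<close> becomes anticommutation: \<open>J\<close> is surjective,
  so the equation for \<open>theta J x\<close> need only be tested on vectors \<open>J v\<close>,
  where \<open>inv J\<close> disappears.\<close>

lemma p_part_iff:
  "x \<in> p_part scale \<Phi> J \<longleftrightarrow> Vector_Spaces.linear scale scale x \<and>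
     (\<forall>u v. \<Phi> (x u) v = - \<Phi> u (x v)) \<and> (\<forall>v. J (x v) = - x (J v))"
  unfolding p_part_def aut_algebra_def
  by (auto simp: fun_eq_iff eq_neg_iff_add_eq_0 simp flip: J_theta) (metis J_theta surj_J)

lemma k_part_iff:
  "x \<in> k_part scale \<Phi> J \<longleftrightarrow> Vector_Spaces.linear scale scale x \<and>
     (\<forall>u v. \<Phi> (x u) v = - \<Phi> u (x v)) \<and> (\<forall>v. J (x v) = x (J v))"
  unfolding k_part_def aut_algebra_def
  by (auto simp: fun_eq_iff eq_neg_iff_add_eq_0 simp flip: J_theta) (metis J_theta surj_J)

text \<open>
  The condition \<open>[[e, f], e] = 2e\<close> is affine in \<open>f\<close> and stable under \<open>f \<mapsto> -f\<^sup>*\<close> and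
  \<open>f \<mapsto> -JfJ\<^sup>-\<^sup>1\<close>, so a solution in \<open>\<pp>\<close> is obtained by averaging.
\<close>

lemma p_part_double_commutator:
  assumes e: "e \<in> p_part scale \<Phi> J" and nil: "\<And>x. (e ^^ N) x = 0"
  shows "\<exists>f\<in>p_part scale \<Phi> J. \<forall>x. scale 2 (e (f (e x))) - f (e (e x)) - e (e (f x)) = scale 2 (e x)"
proof -
  have lin_e: "Vector_Spaces.linear scale scale e" and skew_e: "\<And>u v. \<Phi> (e u) v = - \<Phi> u (e v)"
    and J_e: "\<And>v. J (e v) = - e (J v)" using e by (auto simp: p_part_iff)
  interpret e: Vector_Spaces.linear scale scale e by (rule lin_e)
  obtain f where f: "Vector_Spaces.linear scale scale f"
    and f_eq: "\<And>x. scale 2 (e (f (e x))) - f (e (e x)) - e (e (f x)) = scale 2 (e x)"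
    using nilpotent_double_commutator[OF lin_e, of UNIV N] nil by auto
  interpret f: Vector_Spaces.linear scale scale f by (rule f)
  obtain g where g: "Vector_Spaces.linear scale scale g" and adj: "\<And>u v. \<Phi> (f u) v = \<Phi> u (g v)"
    using adjoint_exists[OF f] by blast
  interpret g: Vector_Spaces.linear scale scale g by (rule g)
  have adj': "\<Phi> (g u) v = \<Phi> u (f v)" for u v
    by (metis adj form_sym)
  \<comment> \<open>Taking adjoints reverses products and negates each \<open>e\<close>. The left
    side has two factors \<open>e\<close>, the right side one, so \<open>- g\<close> solves the same
    equation as \<open>f\<close>.\<close>
  have g_eq: "scale 2 (e (g (e x))) - g (e (e x)) - e (e (g x)) = - scale 2 (e x)" for x
  proof (rule form_eqI)
    fix u
    have "\<Phi> u (scale 2 (e (g (e x))) - g (e (e x)) - e (e (g x)))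
        = \<Phi> (scale 2 (e (f (e u))) - e (e (f u)) - f (e (e u))) x"
      by (simp add: \<Phi>.diff \<Phi>.scale \<Phi>'.diff \<Phi>'.scale skew_e adj)
    also have "\<dots> = \<Phi> (scale 2 (e u)) x"
      using f_eq[of u] by (simp add: algebra_simps)
    finally show "\<Phi> u (scale 2 (e (g (e x))) - g (e (e x)) - e (e (g x))) = \<Phi> u (- scale 2 (e x))"
      by (simp add: \<Phi>.neg \<Phi>.scale \<Phi>'.scale skew_e)
  qed
  define f1 where "f1 x = scale (1/2) (f x - g x)" for x
  have lin_f1: "Vector_Spaces.linear scale scale f1"
    unfolding Vector_Spaces.linear_iff f1_def
    by (simp add: vector_space_axioms f.add f.scale g.add g.scale algebra_simps)
  interpret f1: Vector_Spaces.linear scale scale f1 by (rule lin_f1)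
  have skew_f1: "\<Phi> (f1 u) v = - \<Phi> u (f1 v)" for u v
    by (simp add: f1_def \<Phi>.diff \<Phi>.scale \<Phi>'.diff \<Phi>'.scale adj adj' algebra_simps)
  have f1_eq: "scale 2 (e (f1 (e x))) - f1 (e (e x)) - e (e (f1 x)) = scale 2 (e x)" for x
  proof -
    have "scale 2 (e (f1 (e x))) - f1 (e (e x)) - e (e (f1 x))
        = scale (1/2) ((scale 2 (e (f (e x))) - f (e (e x)) - e (e (f x)))
          - (scale 2 (e (g (e x))) - g (e (e x)) - e (e (g x))))"
      by (simp add: f1_def e.diff e.scale algebra_simps)
    then show ?thesis unfolding f_eq g_eq by (simp add: scale_half_double)
  qed
  have Jf1_eq: "scale 2 (e (J (f1 (J (e x))))) - J (f1 (J (e (e x)))) - e (e (J (f1 (J x))))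
      = scale \<epsilon> (scale 2 (e x))" for x
  proof -
    have eJ: "e (J v) = - J (e v)" for v by (simp add: J_e)
    have "scale 2 (e (J (f1 (J (e x))))) - J (f1 (J (e (e x)))) - e (e (J (f1 (J x))))
        = J (scale 2 (e (f1 (e (J x)))) - f1 (e (e (J x))) - e (e (f1 (J x))))"
      by (simp add: J.diff J.scale J_e e.neg f1.neg J.neg)
    also have "\<dots> = scale \<epsilon> (scale 2 (e x))"
      unfolding f1_eq by (simp add: J.scale J_e J_J e.neg e.scale scale_left_commute)
    finally show ?thesis .
  qed
  \<comment> \<open>As the inverse of \<open>J\<close> is \<open>- \<epsilon> J\<close>, the second
    summand is \<open>- J f1 J^-1\<close>.\<close>
  define f2 where "f2 x = scale (1/2) (f1 x + scale \<epsilon> (J (f1 (J x))))" for x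
  have lin_f2: "Vector_Spaces.linear scale scale f2"
    unfolding Vector_Spaces.linear_iff f2_def
    by (simp add: vector_space_axioms f1.add f1.scale J.add J.scale algebra_simps)
  have "\<Phi> (f2 u) v = - \<Phi> u (f2 v)" for u v
  proof -
    have "\<Phi> (J (f1 (J u))) v = - \<Phi> u (J (f1 (J v)))"
      by (simp add: form_J_left skew_f1 eps_square)
    then show ?thesis
      by (simp only: f2_def \<Phi>.add \<Phi>.scale \<Phi>'.add \<Phi>'.scale skew_f1 mult_minus_right
          flip: minus_add_distrib)
  qed
  moreover have "J (f2 v) = - f2 (J v)" for v
    by (simp add: f2_def J.add J.scale J_J f1.neg f1.scale J.neg eps_square algebra_simps)
  moreover have "scale 2 (e (f2 (e x))) - f2 (e (e x)) - e (e (f2 x)) = scale 2 (e x)" for x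
  proof -
    have "scale 2 (e (f2 (e x))) - f2 (e (e x)) - e (e (f2 x))
        = scale (1/2) ((scale 2 (e (f1 (e x))) - f1 (e (e x)) - e (e (f1 x)))
          + scale \<epsilon> (scale 2 (e (J (f1 (J (e x))))) - J (f1 (J (e (e x)))) - e (e (J (f1 (J x))))))"
      by (simp add: f2_def e.add e.scale algebra_simps)
    then show ?thesis
      unfolding f1_eq Jf1_eq by (simp add: eps_square scale_half_double del: scale_scale) (simp add: eps_square scale_half_double)
  qed
  ultimately show ?thesis
    using lin_f2 by (intro bexI[of _ f2]) (simp_all add: p_part_iff)
qed

lemma bracket_p_p:
  assumes "x \<in> p_part scale \<Phi> J" "y \<in> p_part scale \<Phi> J"
  shows "lie_bracket x y \<in> k_part scale \<Phi> J"
proof -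
  interpret x: Vector_Spaces.linear scale scale x using assms by (simp add: p_part_iff)
  interpret y: Vector_Spaces.linear scale scale y using assms by (simp add: p_part_iff)
  show ?thesis
    using assms unfolding p_part_iff k_part_iff lie_bracket_def
    by (auto simp: Vector_Spaces.linear_iff x.add x.scale x.neg y.add y.scale y.neg
        scale_right_diff_distrib J.diff \<Phi>.diff \<Phi>'.diff)
qed

lemma bracket_k_p:
  assumes "x \<in> k_part scale \<Phi> J" "y \<in> p_part scale \<Phi> J"
  shows "lie_bracket x y \<in> p_part scale \<Phi> J"
proof -
  interpret x: Vector_Spaces.linear scale scale x using assms by (simp add: k_part_iff)
  interpret y: Vector_Spaces.linear scale scale y using assms by (simp add: p_part_iff)
  show ?thesis
    using assms unfolding p_part_iff k_part_iff lie_bracket_def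
    by (auto simp: Vector_Spaces.linear_iff x.add x.scale x.neg y.add y.scale y.neg
        scale_right_diff_distrib J.diff \<Phi>.diff \<Phi>'.diff)
qed

text \<open>With \<open>h = [e, f1]\<close> one has \<open>[h, e] = 2 e\<close>, while
  \<open>[h, f1] = - 2 f1\<close> fails by \<open>z0\<close>. This defect commutes with
  \<open>e\<close>, so Morozov's lemma for the adjoint operators yields \<open>z\<close> in the
  centralizer with \<open>[h, z] + 2 z = z0\<close>, and replacing \<open>f1\<close> by
  \<open>f1 - z\<close> repairs the relation without changing \<open>[e, f1]\<close>.\<close>

lemma normal_triple_exists:
  assumes e: "e \<in> p_part scale \<Phi> J" and nil: "\<And>x. (e ^^ N) x = 0"
  shows "\<exists>h f. is_normal_triple scale \<Phi> J e h f"
proof -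
  define sc :: "'k \<Rightarrow> ('v \<Rightarrow> 'v) \<Rightarrow> 'v \<Rightarrow> 'v" where "sc c x = (\<lambda>v. scale c (x v))" for c x
  have vs_sc: "vector_space sc"
    by unfold_locales (auto simp: sc_def fun_eq_iff algebra_simps)
  interpret fn: vector_space sc by (rule vs_sc)
  interpret self: vector_space_pair scale scale by unfold_locales
  define lin where "lin = self.construct Basis"
  have lin: "Vector_Spaces.linear scale scale (lin x)" for x
    unfolding lin_def by (rule self.linear_construct[OF independent_Basis])
  have lin_id: "lin x = x" if "Vector_Spaces.linear scale scale x" for x
  proof
    show "lin x v = x v" for v
      using self.linear_eq_on[OF lin that, of v Basis]
      by (simp add: span_Basis lin_def self.construct_basis[OF independent_Basis])
  qed
  have lin_add: "lin (x + y) v = lin x v + lin y v" for x y v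
    unfolding lin_def plus_fun_def
    by (metis self.construct_add[OF independent_Basis])
  have lin_sc: "lin (sc c x) v = scale c (lin x v)" for c x v
    unfolding lin_def sc_def
    by (metis self.construct_scale[OF independent_Basis])
  \<comment> \<open>The relations of the adjoint representation hold for linear operators only; precomposing
    with \<open>lin\<close> extends them to all functions.\<close>
  define ad where "ad x y = lie_bracket x (lin y)" for x y
  have lin_bracket: "Vector_Spaces.linear scale scale (lie_bracket x y)"
    if "Vector_Spaces.linear scale scale x" "Vector_Spaces.linear scale scale y" for x y
  proof -
    interpret x: Vector_Spaces.linear scale scale x by (rule that)
    interpret y: Vector_Spaces.linear scale scale y by (rule that)
    show ?thesis
      by (simp add: Vector_Spaces.linear_iff vector_space_axioms lie_bracket_def x.add x.scale
          y.add y.scale scale_right_diff_distrib)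
  qed
  have lin_ad: "Vector_Spaces.linear sc sc (ad x)"
    if "Vector_Spaces.linear scale scale x" for x :: "'v \<Rightarrow> 'v"
  proof -
    interpret x: Vector_Spaces.linear scale scale x by (rule that)
    show ?thesis
      by (simp add: Vector_Spaces.linear_iff vs_sc ad_def lie_bracket_def fun_eq_iff lin_add lin_sc
          x.add x.scale) (simp add: sc_def scale_right_diff_distrib)
  qed
  obtain f1 where f1: "f1 \<in> p_part scale \<Phi> J"
    "\<And>x. scale 2 (e (f1 (e x))) - f1 (e (e x)) - e (e (f1 x)) = scale 2 (e x)"
    using p_part_double_commutator[OF e nil] by blast
  define h where "h = lie_bracket e f1"
  have h: "h \<in> k_part scale \<Phi> J" unfolding h_def by (rule bracket_p_p[OF e f1(1)])
  interpret e: Vector_Spaces.linear scale scale e using e by (simp add: p_part_iff)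
  interpret h: Vector_Spaces.linear scale scale h using h by (simp add: k_part_iff)
  interpret f1: Vector_Spaces.linear scale scale f1 using f1 by (simp add: p_part_iff)
  have he: "h (e v) = e (h v) + scale 2 (e v)" for v
    using f1(2)[of v] by (simp add: h_def lie_bracket_def e.diff scale_2 algebra_simps)
  have ad_ad: "ad x (ad y z) = lie_bracket x (lie_bracket y (lin z))"
    if "Vector_Spaces.linear scale scale y" for x y z
    unfolding ad_def by (simp only: lin_id[OF lin_bracket[OF that lin]])
  interpret ad: raising_pair sc "ad e" "ad h" "ad f1"
  proof (intro raising_pair.intro raising_pair_axioms.intro vs_sc lin_ad
      e.linear_axioms h.linear_axioms f1.linear_axioms)
    fix x
    interpret x: Vector_Spaces.linear scale scale "lin x" by (rule lin)
    show "ad h (ad e x) = ad e (ad h x) + sc 2 (ad e x)"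
      unfolding ad_ad[OF e.linear_axioms] ad_ad[OF h.linear_axioms]
      by (simp add: ad_def lie_bracket_def sc_def fun_eq_iff e.diff h.diff he x.add x.scale
          scale_right_diff_distrib)
    show "ad e (ad f1 x) = ad f1 (ad e x) + ad h x"
      unfolding ad_ad[OF e.linear_axioms] ad_ad[OF f1.linear_axioms]
      by (simp add: ad_def lie_bracket_def h_def fun_eq_iff e.diff f1.diff x.diff)
  qed
  have pow_e_0: "(e ^^ k) 0 = 0" for k by (induction k) auto
  have pow_e_big: "(e ^^ k) w = 0" if "N \<le> k" for k w
  proof -
    have "(e ^^ k) w = (e ^^ (k - N)) ((e ^^ N) w)"
      using that by (simp flip: funpow_add comp_apply[of "e ^^ _" "e ^^ _"])
    then show ?thesis by (simp add: nil pow_e_0)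
  qed
  \<comment> \<open>\<open>(ad e)^n x\<close> is a combination of operators \<open>e^a x e^b\<close>
    with \<open>a + b = n\<close>, and one exponent reaches N. The extra powers i and j let the
    induction proceed without binomial coefficients.\<close>
  have pow_ad: "(e ^^ i) (lin ((ad e ^^ n) x) ((e ^^ j) v)) = 0" if "2 * N \<le> i + j + n" for n i j x v
    using that
  proof (induction n arbitrary: i j)
    case 0
    interpret x: Vector_Spaces.linear scale scale "lin x" by (rule lin)
    consider "N \<le> i" | "N \<le> j" using 0 by linarith
    then show ?case by cases (simp_all add: pow_e_big pow_e_0)
  next
    case (Suc n)
    interpret ei: Vector_Spaces.linear scale scale "e ^^ i" by (intro linear_pow e.linear_axioms)
    have "lin ((ad e ^^ Suc n) x) = lie_bracket e (lin ((ad e ^^ n) x))"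
      unfolding funpow.simps comp_apply ad_def by (intro lin_id lin_bracket e.linear_axioms lin)
    then have "(e ^^ i) (lin ((ad e ^^ Suc n) x) ((e ^^ j) v))
        = (e ^^ Suc i) (lin ((ad e ^^ n) x) ((e ^^ j) v))
          - (e ^^ i) (lin ((ad e ^^ n) x) ((e ^^ Suc j) v))"
      by (simp add: lie_bracket_def ei.diff funpow_swap1)
    then show ?case using Suc.IH[of "Suc i" j] Suc.IH[of i "Suc j"] Suc.prems by simp
  qed
  \<comment> \<open>One more power than \<open>2 * N\<close>: \<open>pow_ad\<close> controls only
    \<open>lin\<close> of the iterate, and the outer \<open>ad e\<close> supplies that
    \<open>lin\<close>.\<close>
  have nil_ad: "(ad e ^^ Suc (2 * N)) x = 0" for x
    using pow_ad[of 0 0 "2 * N" x] by (simp add: ad_def lie_bracket_def fun_eq_iff)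
  have ad_p: "ad x y = lie_bracket x y" if "y \<in> p_part scale \<Phi> J" for x y
    using that by (simp add: ad_def lin_id p_part_iff)
  define z0 where "z0 = lie_bracket h f1 + sc 2 f1"
  have sub: "fn.subspace (p_part scale \<Phi> J)"
    unfolding fn.subspace_def
    by (auto simp: p_part_iff Vector_Spaces.linear_iff sc_def vector_space_axioms \<Phi>.add \<Phi>'.add
        \<Phi>.scale \<Phi>'.scale \<Phi>.zero \<Phi>'.zero J.add J.scale algebra_simps)
  have z0: "z0 \<in> p_part scale \<Phi> J"
    unfolding z0_def using bracket_k_p[OF h f1(1)] f1(1) sub
    by (intro fn.subspace_add fn.subspace_scale)
  have ez0: "lie_bracket e z0 = 0"
  proof -
    have "ad e (ad h f1) = lie_bracket h h - sc 2 h"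
      using ad.HE[of f1] ad_p[OF f1(1)] lin_id[OF h.linear_axioms]
      by (simp add: h_def[symmetric]) (simp add: ad_def algebra_simps)
    moreover have "lie_bracket e z0 = ad e (ad h f1) + sc 2 h"
      using ad_p[OF f1(1)] ad_p[OF z0] unfolding z0_def
      by (metis ad.E.add ad.E.scale h_def)
    ultimately show ?thesis by (simp add: lie_bracket_def fun_eq_iff)
  qed
  obtain z where z: "z \<in> p_part scale \<Phi> J" "lie_bracket e z = 0"
    "lie_bracket h z + sc 2 z = z0"
    using ad.H_plus_2_surj_on_ker_E[OF nil_ad sub, of z0] z0 ez0 bracket_k_p[OF h] by (metis ad_p)
  define f where "f = f1 - z"
  have f_p: "f \<in> p_part scale \<Phi> J" unfolding f_def by (rule fn.subspace_diff[OF sub f1(1) z(1)])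
  have "lie_bracket e f = h" 
    using z(2) ad.E.diff[of f1 z] ad_p[OF f1(1)] ad_p[OF z(1)] ad_p[OF f_p]
    by (simp add: f_def h_def)
  moreover have "lie_bracket h f = sc (- 2) f"
  proof -
    have "lie_bracket h f = lie_bracket h f1 - lie_bracket h z"
      using ad.H.diff[of f1 z] ad_p[OF f1(1)] ad_p[OF z(1)] ad_p[OF f_p] by (simp add: f_def)
    also have "\<dots> = (lie_bracket h f1 + sc 2 f1) - (lie_bracket h z + sc 2 z) + (sc 2 z - sc 2 f1)"
      by simp
    also have "\<dots> = sc 2 z - sc 2 f1" using z(3) unfolding z0_def by simp
    finally show ?thesis by (simp add: f_def fn.scale_right_diff_distrib)
  qed
  moreover have "lie_bracket h e = (\<lambda>v. scale 2 (e v))"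
    by (simp add: lie_bracket_def fun_eq_iff he)
  ultimately show ?thesis
    using e h f_p unfolding is_normal_triple_def sc_def by blast
qed

end

subsection \<open>The form on lowest weight vectors\<close>

locale normal_triple_space = polarized_space scale Basis \<Phi> J \<epsilon>
  for scale :: "'k::field_char_0 \<Rightarrow> 'v::ab_group_add \<Rightarrow> 'v" and Basis \<Phi> J \<epsilon> +
  fixes e h f :: "'v \<Rightarrow> 'v" and N :: nat
  assumes triple: "is_normal_triple scale \<Phi> J e h f"
    and pow_e_zero: "(e ^^ N) x = 0"
begin

lemma e_in_p: "e \<in> p_part scale \<Phi> J" and f_in_p: "f \<in> p_part scale \<Phi> J"
  and h_in_k: "h \<in> k_part scale \<Phi> J"
  using triple by (auto simp: is_normal_triple_def)

lemma
  shows lin_e: "Vector_Spaces.linear scale scale e" and lin_h: "Vector_Spaces.linear scale scale h"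
    and lin_f: "Vector_Spaces.linear scale scale f"
    and skew_e: "\<Phi> (e u) v = - \<Phi> u (e v)" and skew_h: "\<Phi> (h u) v = - \<Phi> u (h v)"
    and J_e: "J (e v) = - e (J v)" and J_f: "J (f v) = - f (J v)" and J_h: "J (h v) = h (J v)"
  using e_in_p f_in_p h_in_k by (auto simp: p_part_iff k_part_iff)

lemma h_e: "h (e v) = e (h v) + scale 2 (e v)"
proof -
  have "lie_bracket h e v = scale 2 (e v)" using triple by (simp add: is_normal_triple_def)
  then show ?thesis by (simp add: lie_bracket_def diff_eq_eq add.commute)
qed

lemma h_f: "h (f v) = f (h v) - scale 2 (f v)"
proof -
  have "lie_bracket h f v = scale (- 2) (f v)" using triple by (simp add: is_normal_triple_def)
  then show ?thesis by (simp add: lie_bracket_def diff_eq_eq)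
qed

lemma e_f: "e (f v) = f (e v) + h v"
proof -
  have "lie_bracket e f v = h v" using triple by (simp add: is_normal_triple_def)
  then show ?thesis by (simp add: lie_bracket_def diff_eq_eq add.commute)
qed

sublocale e: Vector_Spaces.linear scale scale e by (rule lin_e)
sublocale h: Vector_Spaces.linear scale scale h by (rule lin_h)
sublocale f: Vector_Spaces.linear scale scale f by (rule lin_f)

text \<open>The roles of \<open>e\<close> and \<open>f\<close> are exchanged and \<open>h\<close> is
  negated, since the rows of the diagram are strings generated by \<open>e\<close> from lowest
  weight vectors. Nilpotency of \<open>f\<close>, required for the exchange, comes from the
  unexchanged copy \<open>up\<close>.\<close>

sublocale low: sl2_nilpotent scale f "\<lambda>v. - h v" e N
proof -
  interpret up: sl2_nilpotent scale e h f N
    by (intro sl2_nilpotent.intro sl2_nilpotent_axioms.intro raising_pair.intro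
        raising_pair_axioms.intro vector_space_axioms lin_e lin_h lin_f h_e h_f e_f pow_e_zero)
  show "sl2_nilpotent scale f (\<lambda>v. - h v) e N"
    by (intro sl2_nilpotent.intro sl2_nilpotent_axioms.intro raising_pair.intro
        raising_pair_axioms.intro vector_space_axioms lin_e lin_f up.pow_F_zero)
       (simp_all add: Vector_Spaces.linear_iff vector_space_axioms h.add h.scale h_e h_f e_f e.neg f.neg)
qed

text \<open>\<open>L m\<close> is \<open>H'_d\<close> with \<open>d = m + 1\<close>: the weight is
  -m and the string of \<open>v\<close> ends at \<open>e^m v\<close>.\<close>

abbreviation L :: "nat \<Rightarrow> 'v set" where "L \<equiv> low.highest"

lemma L_iff: "v \<in> L m \<longleftrightarrow> f v = 0 \<and> h v = scale (- of_nat m) v"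
  by (auto simp: low.highest_def minus_equation_iff[of "h v"])

lemma h_pow_e: "v \<in> L m \<Longrightarrow> h ((e ^^ j) v) = scale (of_int (2 * int j - int m)) ((e ^^ j) v)"
  using low.H_pow_F[of v "of_nat m" j]
  by (simp add: low.highest_def minus_equation_iff[of "h _"] scale_left_diff_distrib)

lemma lin_pow_e: "Vector_Spaces.linear scale scale (e ^^ j)"
  by (intro linear_pow lin_e)

sublocale pow_e: Vector_Spaces.linear scale scale "e ^^ j" for j
  by (rule lin_pow_e)

lemma pow_e_add: "(e ^^ i) ((e ^^ j) v) = (e ^^ (i + j)) v"
  by (simp add: funpow_add)

lemma form_pow_e: "\<Phi> ((e ^^ j) u) v = (-1) ^ j * \<Phi> u ((e ^^ j) v)"
  by (induction j arbitrary: u v) (simp_all add: skew_e funpow_swap1)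

lemma J_pow_e: "J ((e ^^ j) v) = scale ((-1) ^ j) ((e ^^ j) (J v))"
  by (induction j) (simp_all add: J_e e.scale)

lemma pow_e_big:
  assumes "v \<in> L m" "m < j"
  shows "(e ^^ j) v = 0"
proof -
  have "(e ^^ j) v = (e ^^ (j - Suc m)) ((e ^^ Suc m) v)"
    using assms by (simp add: pow_e_add del: funpow.simps)
  then show ?thesis by (simp only: low.pow_F_highest_zero[OF assms(1)] pow_e.zero)
qed

lemma L_trivial:
  assumes "v \<in> L m" "N \<le> m"
  shows "v = 0"
proof (rule ccontr)
  assume "v \<noteq> 0"
  then have "(e ^^ N) v \<noteq> 0" using low.pow_F_highest_nonzero assms by blast
  then show False using pow_e_zero by simp
qed

lemma form_weight_zero:
  assumes "h u = scale (of_int a) u" "h v = scale (of_int b) v" "a + b \<noteq> 0"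
  shows "\<Phi> u v = 0"
proof -
  have "of_int a * \<Phi> u v = - (of_int b * \<Phi> u v)"
    using skew_h[of u v] by (simp add: assms \<Phi>.scale \<Phi>'.scale)
  then have "of_int (a + b) * \<Phi> u v = 0" by (simp add: algebra_simps)
  then show ?thesis using assms(3) by (simp only: mult_eq_0_iff of_int_eq_0_iff) simp
qed

lemma form_strings_zero:
  assumes "u \<in> L m" "v \<in> L n" "2 * int i - int m + (2 * int j - int n) \<noteq> 0"
  shows "\<Phi> ((e ^^ i) u) ((e ^^ j) v) = 0"
  using form_weight_zero[OF h_pow_e[OF assms(1)] h_pow_e[OF assms(2)] assms(3)] .

abbreviation strings :: "'v set" where
  "strings \<equiv> {(e ^^ j) v | j v m. v \<in> L m \<and> j \<le> m}"

lemma zero_if_form_strings_zero: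
  assumes "\<And>u m j. u \<in> L m \<Longrightarrow> j \<le> m \<Longrightarrow> \<Phi> ((e ^^ j) u) v = 0"
  shows "v = 0"
proof (rule nondeg)
  fix x
  have "x \<in> span strings" using low.span_strings by blast
  then show "\<Phi> x v = 0"
    by (induction rule: span_inductI) (auto simp: \<Phi>'.zero \<Phi>'.add \<Phi>'.scale assms)
qed

section \<open>The forms induced on lowest weight vectors\<close>

definition pairing :: "nat \<Rightarrow> 'v \<Rightarrow> 'v \<Rightarrow> 'k" where
  "pairing m u v = \<Phi> u ((e ^^ m) v)"

definition sgn_of :: "nat \<Rightarrow> 'k" where
  "sgn_of m = (-1) ^ m * \<epsilon>"

lemma sgn_of_square [simp]: "sgn_of m * sgn_of m = 1" "sgn_of m * (sgn_of m * x) = x"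
proof -
  have "sgn_of m * sgn_of m = ((-1) ^ m * (-1) ^ m) * (\<epsilon> * \<epsilon>)"
    by (simp only: sgn_of_def mult_ac)
  then show "sgn_of m * sgn_of m = 1" by (simp add: eps_square minus_one_mult_self)
  then show "sgn_of m * (sgn_of m * x) = x" by (simp flip: mult.assoc)
qed

lemma pairing_sym: "pairing m u v = sgn_of m * pairing m v u"
proof -
  have "pairing m v u = (-1) ^ m * \<Phi> ((e ^^ m) v) u" unfolding pairing_def form_pow_e by simp
  also have "\<dots> = sgn_of m * pairing m u v"
    unfolding pairing_def sgn_of_def form_sym[of "(e ^^ m) v" u] by simp
  finally show ?thesis by simp
qed

lemma pairing_linear:
  "pairing m (u + v) w = pairing m u w + pairing m v w"
  "pairing m (scale c u) w = c * pairing m u w"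
  "pairing m (u - v) w = pairing m u w - pairing m v w"
  "pairing m w (u + v) = pairing m w u + pairing m w v"
  "pairing m w (scale c u) = c * pairing m w u"
  "pairing m w (u - v) = pairing m w u - pairing m w v"
  by (simp_all add: pairing_def pow_e.add pow_e.scale pow_e.diff \<Phi>.add \<Phi>.scale \<Phi>.diff
      \<Phi>'.add \<Phi>'.scale \<Phi>'.diff)

text \<open>\<open>e^m v\<close> has weight m, so only vectors of weight -m can pair with it. Those
  of the form \<open>e^j u\<close> with \<open>j > 0\<close> pair to zero because
  \<open>e^(m+j) v = 0\<close>, and the rest lie in \<open>L m\<close>. Hence
  \<open>e^m v = 0\<close>, and strings do not break off early.\<close>

lemma pairing_nondeg:
  assumes "v \<in> L m" "\<And>u. u \<in> L m \<Longrightarrow> pairing m u v = 0"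
  shows "v = 0"
proof -
  have "(e ^^ m) v = 0"
  proof (rule zero_if_form_strings_zero)
    fix u n j assume u: "u \<in> L n" "j \<le> n"
    show "\<Phi> ((e ^^ j) u) ((e ^^ m) v) = 0"
    proof (cases "j = 0")
      case True
      show ?thesis
      proof (cases "n = m")
        case True
        then show ?thesis using assms(2) u \<open>j = 0\<close> by (simp add: pairing_def)
      qed (use True form_strings_zero[OF u(1) assms(1), of j m] in simp)
    next
      case False
      have "\<Phi> ((e ^^ j) u) ((e ^^ m) v) = (-1) ^ j * \<Phi> u ((e ^^ (j + m)) v)"
        by (simp add: form_pow_e pow_e_add)
      then show ?thesis using pow_e_big[OF assms(1), of "j + m"] False by (simp add: \<Phi>.zero)
    qed
  qed
  then show ?thesis using low.pow_F_highest_nonzero[OF assms(1)] by blast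
qed

text \<open>Moving \<open>J\<close> across \<open>\<Phi>\<close> costs \<open>- \<epsilon>\<close>
  and moving it past \<open>e^m\<close> costs \<open>(-1)^m\<close>; the product is
  \<open>- sgn_of m\<close>.\<close>

lemma pairing_eigen:
  assumes "J u = scale \<nu> u" "J v = scale \<mu> v" "\<nu> \<noteq> - (sgn_of m * \<mu>)"
  shows "pairing m u v = 0"
proof -
  have "\<nu> * pairing m u v = \<Phi> (J u) ((e ^^ m) v)"
    by (simp add: assms(1) pairing_def \<Phi>'.scale)
  also have "\<dots> = - (sgn_of m * \<mu>) * pairing m u v"
    unfolding form_J_left J_pow_e assms(2) \<Phi>.scale pow_e.scale pairing_def sgn_of_def
    by (simp only: mult_ac mult_minus_left mult_minus_right)
  finally show ?thesis using assms(3) by (metis mult_right_cancel)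
qed

section \<open>Centralizer elements built from two strings\<close>

definition string_op :: "nat \<Rightarrow> 'v \<Rightarrow> 'v \<Rightarrow> 'v \<Rightarrow> 'v" where
  "string_op m u w x = (\<Sum>j<Suc m. scale ((-1) ^ j * \<Phi> x ((e ^^ (m - j)) w)) ((e ^^ j) u))"

lemma string_op_linear: "Vector_Spaces.linear scale scale (string_op m u w)"
  unfolding Vector_Spaces.linear_iff string_op_def
  by (simp only: vector_space_axioms \<Phi>'.add \<Phi>'.scale distrib_left scale_left_distrib sum.distrib
      scale_sum_right scale_scale mult.left_commute) simp

lemma string_op_adjoint: "\<Phi> (string_op m u w x) z = sgn_of m * \<Phi> x (string_op m w u z)"
proof -
  have "\<Phi> x (string_op m w u z)
      = (\<Sum>j<Suc m. (-1) ^ j * \<Phi> z ((e ^^ (m - j)) u) * \<Phi> x ((e ^^ j) w))"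
    by (simp only: string_op_def \<Phi>.sum \<Phi>.scale)
  also have "\<dots> = (\<Sum>j<Suc m. (-1) ^ (m - j) * \<Phi> z ((e ^^ j) u) * \<Phi> x ((e ^^ (m - j)) w))"
    by (subst sum.nat_diff_reindex[symmetric]) (intro sum.cong, auto)
  also have "sgn_of m * \<dots> = (\<Sum>j<Suc m. (-1) ^ j * \<Phi> x ((e ^^ (m - j)) w) * \<Phi> ((e ^^ j) u) z)"
    unfolding sum_distrib_left
  proof (intro sum.cong refl)
    fix j assume "j \<in> {..<Suc m}"
    then have m: "(-1) ^ m = (-1) ^ (m - j) * (-1 :: 'k) ^ j" by (simp flip: power_add)
    define a :: 'k where "a = (-1) ^ (m - j)"
    define b :: 'k where "b = (-1) ^ j"
    have "a * a = 1" by (simp add: a_def minus_one_mult_self)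
    have "(a * b * \<epsilon>) * (a * \<Phi> z ((e ^^ j) u) * \<Phi> x ((e ^^ (m - j)) w))
        = (a * a) * (b * \<Phi> x ((e ^^ (m - j)) w) * (\<epsilon> * \<Phi> z ((e ^^ j) u)))"
      by (simp only: mult_ac)
    then show "sgn_of m * ((-1) ^ (m - j) * \<Phi> z ((e ^^ j) u) * \<Phi> x ((e ^^ (m - j)) w))
        = (-1) ^ j * \<Phi> x ((e ^^ (m - j)) w) * \<Phi> ((e ^^ j) u) z"
      unfolding sgn_of_def m form_sym[of "(e ^^ j) u" z] \<open>a * a = 1\<close> by (simp add: a_def b_def)
  qed
  also have "\<dots> = \<Phi> (string_op m u w x) z"
    by (simp only: string_op_def \<Phi>'.sum \<Phi>'.scale)
  finally show ?thesis by simp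
qed

text \<open>The reversed exponent makes each summand of \<open>string_op\<close> preserve weights,
  and the alternating sign cancels the skewness of \<open>e\<close>. After shifting the index by
  one, the end terms vanish as \<open>e^(m+1)\<close> kills \<open>u\<close> and
  \<open>w\<close>.\<close>

lemma string_op_e:
  assumes "u \<in> L m" "w \<in> L m"
  shows "string_op m u w (e x) = e (string_op m u w x)"
proof -
  have "string_op m u w (e x) = (\<Sum>j<Suc m. scale (- ((-1) ^ j * \<Phi> x ((e ^^ Suc (m - j)) w))) ((e ^^ j) u))"
    by (simp add: string_op_def skew_e)
  also have "\<dots> = (\<Sum>j<m. scale ((-1) ^ j * \<Phi> x ((e ^^ Suc (m - Suc j)) w)) ((e ^^ Suc j) u))"
    unfolding sum.lessThan_Suc_shift using pow_e_big[OF assms(2), of "Suc m"]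
    by (simp add: \<Phi>.zero del: funpow.simps)
  also have "\<dots> = (\<Sum>j<m. scale ((-1) ^ j * \<Phi> x ((e ^^ (m - j)) w)) ((e ^^ Suc j) u))"
    by (intro sum.cong) (auto simp: Suc_diff_Suc simp del: funpow.simps)
  also have "\<dots> = e (string_op m u w x)"
    unfolding string_op_def using pow_e_big[OF assms(1), of "Suc m"]
    by (simp add: e.sum e.scale e.add)
  finally show ?thesis .
qed

lemma string_op_h:
  assumes "u \<in> L m" "w \<in> L m"
  shows "string_op m u w (h x) = h (string_op m u w x)"
  unfolding string_op_def h.sum h.scale
proof (intro sum.cong refl)
  fix j assume j: "j \<in> {..<Suc m}"
  have "\<Phi> (h x) ((e ^^ (m - j)) w) = - of_int (2 * int (m - j) - int m) * \<Phi> x ((e ^^ (m - j)) w)"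
    unfolding skew_h h_pow_e[OF assms(2)] \<Phi>.scale by (simp only: mult_minus_left)
  also have "- of_int (2 * int (m - j) - int m) = (of_int (2 * int j - int m) :: 'k)"
    using j by (simp add: of_nat_diff)
  finally show "scale ((-1) ^ j * \<Phi> (h x) ((e ^^ (m - j)) w)) ((e ^^ j) u)
      = scale ((-1) ^ j * \<Phi> x ((e ^^ (m - j)) w)) (h ((e ^^ j) u))"
    unfolding h_pow_e[OF assms(1)] by (simp only: scale_scale mult_ac)
qed

lemma string_op_J:
  assumes "J u = scale (sgn_of m * \<mu>) u" "J w = scale \<mu> w"
  shows "J (string_op m u w x) = - string_op m u w (J x)"
  unfolding string_op_def J.sum J.scale sum_negf[symmetric]
proof (intro sum.cong refl)
  fix j assume "j \<in> {..<Suc m}"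
  then have m: "(-1) ^ m = (-1) ^ (m - j) * (-1 :: 'k) ^ j" by (simp flip: power_add)
  have "\<Phi> (J x) ((e ^^ (m - j)) w) = - (\<epsilon> * ((-1) ^ (m - j) * (\<mu> * \<Phi> x ((e ^^ (m - j)) w))))"
    unfolding form_J_left J_pow_e assms(2) pow_e.scale \<Phi>.scale by simp
  moreover have "J ((e ^^ j) u) = scale ((-1) ^ j * (sgn_of m * \<mu>)) ((e ^^ j) u)"
    unfolding J_pow_e assms(1) pow_e.scale by simp
  moreover define a :: 'k where "a = (-1) ^ (m - j)"
  moreover define b :: 'k where "b = (-1) ^ j"
  moreover have "(b * \<Phi> x ((e ^^ (m - j)) w)) * (b * (a * b * \<epsilon> * \<mu>))
      = (b * b) * (b * (\<epsilon> * (a * (\<mu> * \<Phi> x ((e ^^ (m - j)) w)))))"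
    by (simp only: mult_ac)
  moreover have "b * b = 1" by (simp add: b_def minus_one_mult_self)
  ultimately show "scale ((-1) ^ j * \<Phi> x ((e ^^ (m - j)) w)) (J ((e ^^ j) u))
      = - scale ((-1) ^ j * \<Phi> (J x) ((e ^^ (m - j)) w)) ((e ^^ j) u)"
    by (simp add: sgn_of_def m)
qed

text \<open>By weights only the summand \<open>j = 0\<close> survives, so calculations on
  \<open>L m\<close> reduce to rank one operators.\<close>

lemma string_op_L:
  assumes "u \<in> L m" "w \<in> L m" "x \<in> L m"
  shows "string_op m u w x = scale (pairing m x w) u"
proof -
  have "scale ((-1) ^ j * \<Phi> x ((e ^^ (m - j)) w)) ((e ^^ j) u) = 0" if "j \<noteq> 0" "j \<le> m" for j
    using form_strings_zero[OF assms(3,2), of 0 "m - j"] that by (simp add: of_nat_diff)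
  then have "(\<Sum>j\<in>{..<Suc m} - {0}. scale ((-1) ^ j * \<Phi> x ((e ^^ (m - j)) w)) ((e ^^ j) u)) = 0"
    by (intro sum.neutral) auto
  then show ?thesis
    unfolding string_op_def pairing_def by (subst sum.remove[of _ 0]) auto
qed

text \<open>An operator minus its adjoint, by \<open>string_op_adjoint\<close>; hence skew for
  \<open>\<Phi>\<close>.\<close>

definition skew_op :: "nat \<Rightarrow> 'v \<Rightarrow> 'v \<Rightarrow> 'v \<Rightarrow> 'v" where
  "skew_op m u w x = string_op m u w x - scale (sgn_of m) (string_op m w u x)"

lemma skew_op_linear: "Vector_Spaces.linear scale scale (skew_op m u w)"
proof -
  interpret a: Vector_Spaces.linear scale scale "string_op m u w" by (rule string_op_linear)
  interpret b: Vector_Spaces.linear scale scale "string_op m w u" by (rule string_op_linear)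
  show ?thesis
    unfolding Vector_Spaces.linear_iff skew_op_def
    by (simp add: vector_space_axioms a.add a.scale b.add b.scale scale_right_diff_distrib
        scale_right_distrib scale_left_commute)
qed

lemma skew_op_in_p:
  assumes "J u = scale \<nu> u" "J w = scale (sgn_of m * \<nu>) w"
  shows "skew_op m u w \<in> p_part scale \<Phi> J"
proof -
  have "J (string_op m u w x) = - string_op m u w (J x)" for x
    using assms by (intro string_op_J[of u m "sgn_of m * \<nu>"]) simp_all
  moreover have "J (string_op m w u x) = - string_op m w u (J x)" for x
    using assms by (intro string_op_J[of w m \<nu>]) simp_all
  ultimately show ?thesis
    using skew_op_linear unfolding p_part_iff
    by (simp add: skew_op_def J.diff J.scale \<Phi>.diff \<Phi>'.diff \<Phi>.scale \<Phi>'.scale string_op_adjoint)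
qed

lemma skew_op_commute:
  assumes "u \<in> L m" "w \<in> L m"
  shows "skew_op m u w (e x) = e (skew_op m u w x)" "skew_op m u w (h x) = h (skew_op m u w x)"
  using assms by (simp_all add: skew_op_def string_op_e string_op_h e.diff e.scale h.diff h.scale)

lemma skew_op_L:
  assumes "u \<in> L m" "w \<in> L m" "x \<in> L m"
  shows "skew_op m u w x = scale (pairing m x w) u - scale (sgn_of m * pairing m x u) w"
  using assms by (simp add: skew_op_def string_op_L)

text \<open>The image lies in the span of the \<open>e\<close>-strings of \<open>u\<close> and
  \<open>w\<close>. As the operator commutes with \<open>e\<close>, it kills these strings once it
  kills \<open>u\<close> and \<open>w\<close>, and that is isotropy of their span.\<close>

lemma skew_op_square_zero:
  assumes "u \<in> L m" "w \<in> L m" "pairing m u u = 0" "pairing m u w = 0" "pairing m w w = 0"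
  shows "skew_op m u w (skew_op m u w x) = 0"
proof -
  interpret y: Vector_Spaces.linear scale scale "skew_op m u w" by (rule skew_op_linear)
  have "pairing m w u = 0" using pairing_sym[of m w u] assms(4) by simp
  then have 0: "skew_op m u w u = 0" "skew_op m u w w = 0"
    using assms by (simp_all add: skew_op_L)
  have "skew_op m u w ((e ^^ j) z) = (e ^^ j) (skew_op m u w z)" for j z
    by (induction j) (simp_all add: skew_op_commute[OF assms(1,2)])
  then have "skew_op m u w (string_op m u w x) = 0" "skew_op m u w (string_op m w u x) = 0"
    unfolding string_op_def y.sum y.scale by (simp_all add: 0 pow_e.zero)
  then show ?thesis
    by (subst (2) skew_op_def) (simp add: y.diff y.scale)
qed

text \<open>
  On \<open>L m\<close> the sum of the two operators acts on the plane spanned by \<open>u'\<close> and \<open>w\<close> as a rotation.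
\<close>

lemma hyperbolic_obstruction:
  assumes "u \<in> L m" "w \<in> L m" "u' \<in> L m" "w' \<in> L m"
    and J: "J u = scale \<nu> u" "J w = scale (sgn_of m * \<nu>) w"
      "J u' = scale \<nu>' u'" "J w' = scale (sgn_of m * \<nu>') w'"
    and isotropic: "pairing m u u = 0" "pairing m u w = 0" "pairing m w w = 0"
    and dual: "pairing m u' u = 1" "pairing m w' w = 1" "pairing m u' w = 0" "pairing m w' u = 0"
      "pairing m u' u' = 0" "pairing m u' w' = 0"
  shows "\<not> p_centralizer scale \<Phi> J e \<subseteq> nilpotent_cone scale \<Phi> J"
    and "\<exists>y\<in>p_centralizer scale \<Phi> J e. lie_bracket h y = (\<lambda>_. 0) \<and>
      y \<in> nilpotent_cone scale \<Phi> J \<and> y \<noteq> (\<lambda>_. 0)"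
proof -
  interpret y: Vector_Spaces.linear scale scale "skew_op m u w" by (rule skew_op_linear)
  interpret y': Vector_Spaces.linear scale scale "skew_op m u' w'" by (rule skew_op_linear)
  have p: "skew_op m u w \<in> p_part scale \<Phi> J" "skew_op m u' w' \<in> p_part scale \<Phi> J"
    using J skew_op_in_p by blast+
  have u'_w: "skew_op m u w u' = scale (- sgn_of m) w"
    using assms by (simp add: skew_op_L)
  have "w \<noteq> 0" using dual(2) by (auto simp: pairing_def pow_e.zero \<Phi>.zero)
  have "sgn_of m \<noteq> 0" using sgn_of_square(1)[of m] by (metis mult_zero_left zero_neq_one)
  have "skew_op m u w \<in> p_centralizer scale \<Phi> J e"
    using p skew_op_commute(1)[OF assms(1,2)] by (simp add: p_centralizer_def lie_bracket_def)
  moreover have "lie_bracket h (skew_op m u w) = (\<lambda>_. 0)"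
    using skew_op_commute(2)[OF assms(1,2)] by (simp add: lie_bracket_def)
  moreover have "skew_op m u w ^^ 2 = (\<lambda>_. 0)"
    using skew_op_square_zero[OF assms(1,2) isotropic] by (simp add: fun_eq_iff numeral_2_eq_2)
  then have "skew_op m u w \<in> nilpotent_cone scale \<Phi> J"
    using p unfolding nilpotent_cone_def by blast
  moreover have "skew_op m u w \<noteq> (\<lambda>_. 0)"
    using u'_w \<open>w \<noteq> 0\<close> \<open>sgn_of m \<noteq> 0\<close> by (metis neg_equal_0_iff_equal scale_eq_0_iff)
  ultimately show "\<exists>y\<in>p_centralizer scale \<Phi> J e. lie_bracket h y = (\<lambda>_. 0) \<and>
      y \<in> nilpotent_cone scale \<Phi> J \<and> y \<noteq> (\<lambda>_. 0)" by blast
  define z where "z x = skew_op m u w x + skew_op m u' w' x" for x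
  have "z \<in> p_part scale \<Phi> J"
    using p unfolding p_part_iff z_def
    by (simp add: Vector_Spaces.linear_iff vector_space_axioms y.add y'.add y.scale y'.scale
        \<Phi>.add \<Phi>'.add J.add scale_right_distrib)
  then have "z \<in> p_centralizer scale \<Phi> J e"
    using skew_op_commute(1)[OF assms(1,2)] skew_op_commute(1)[OF assms(3,4)]
    by (simp add: p_centralizer_def lie_bracket_def z_def e.add)
  moreover have "z \<notin> nilpotent_cone scale \<Phi> J"
  proof
    assume "z \<in> nilpotent_cone scale \<Phi> J"
    then obtain n where n: "z ^^ n = (\<lambda>_. 0)" by (auto simp: nilpotent_cone_def)
    interpret z: Vector_Spaces.linear scale scale z
      using \<open>z \<in> p_part scale \<Phi> J\<close> by (simp add: p_part_iff)
    have "skew_op m u' w' u' = 0" using assms by (simp add: skew_op_L)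
    then have "z u' = scale (- sgn_of m) w" using u'_w by (simp add: z_def)
    moreover have "pairing m w u' = 0" "pairing m w u = 0" "pairing m w w' = sgn_of m"
      using pairing_sym[of m w u'] pairing_sym[of m w u] pairing_sym[of m w w'] dual isotropic
      by simp_all
    then have "z w = scale (sgn_of m) u'"
      using assms by (simp add: z_def skew_op_L)
    ultimately have z2: "z (z u') = - u'" by (simp add: z.scale z.neg)
    have "(z ^^ (2 * k)) u' = scale ((-1) ^ k) u'" for k
    proof (induction k)
      case (Suc k)
      have "(z ^^ (2 * Suc k)) u' = z (z ((z ^^ (2 * k)) u'))" by simp
      then show ?case by (simp add: Suc z.scale z2)
    qed simp
    moreover have "(z ^^ (2 * n)) u' = 0"
      using n z.zero by (simp add: mult_2 funpow_add fun_eq_iff)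
    ultimately have "u' = 0" by (metis power_eq_0_iff scale_eq_0_iff neg_equal_0_iff_equal zero_neq_one)
    then show False using dual(1) by (simp add: pairing_def \<Phi>'.zero)
  qed
  ultimately show "\<not> p_centralizer scale \<Phi> J e \<subseteq> nilpotent_cone scale \<Phi> J" by blast
qed

end

subsection \<open>Elements of the centralizer\<close>

lemma eq_minus_self: "x = - x \<Longrightarrow> x = (0 :: 'a::field_char_0)"
  by (metis add.right_inverse mult_2 mult_eq_0_iff zero_neq_numeral)

context normal_triple_space begin

lemma p_centralizerD:
  assumes "y \<in> p_centralizer scale \<Phi> J e"
  shows "y \<in> p_part scale \<Phi> J" "e (y v) = y (e v)"
  using assms by (simp_all add: p_centralizer_def lie_bracket_def fun_eq_iff)

text \<open>The sum of the weight spaces of weight at least k, given by generators so that induction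
  over a span applies.\<close>

definition strings_ge :: "int \<Rightarrow> 'v set" where
  "strings_ge k = span {(e ^^ j) v | j v m. v \<in> L m \<and> j \<le> m \<and> k \<le> 2 * int j - int m}"

lemma strings_ge_base: "v \<in> L m \<Longrightarrow> k \<le> 2 * int j - int m \<Longrightarrow> (e ^^ j) v \<in> strings_ge k"
  using pow_e_big[of v m j] unfolding strings_ge_def
  by (cases "j \<le> m") (auto intro: span_base span_zero)

lemma strings_ge_antimono: "k \<le> l \<Longrightarrow> strings_ge l \<subseteq> strings_ge k"
  unfolding strings_ge_def by (intro span_mono) force

lemma pow_e_strings_ge:
  assumes "x \<in> strings_ge k"
  shows "(e ^^ j) x \<in> strings_ge (k + 2 * int j)"
  using assms unfolding strings_ge_def[of k]
proof (induction x rule: span_inductI)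
  case (base x)
  then obtain i v m where "x = (e ^^ i) v" "v \<in> L m" "k \<le> 2 * int i - int m" by blast
  then show ?case using strings_ge_base[of v m "k + 2 * int j" "j + i"] by (simp add: pow_e_add)
qed (auto simp: pow_e.zero pow_e.add pow_e.scale strings_ge_def intro: span_zero span_add span_scale)

lemma form_strings_ge:
  assumes "x \<in> strings_ge k" "u \<in> L n" "k + (2 * int i - int n) > 0"
  shows "\<Phi> x ((e ^^ i) u) = 0"
  using assms(1) unfolding strings_ge_def
proof (induction x rule: span_inductI)
  case (base x)
  then show ?case using form_strings_zero[OF _ assms(2)] assms(3) by fastforce
qed (auto simp: \<Phi>'.zero \<Phi>'.add \<Phi>'.scale)

text \<open>Weights at least k form the orthogonal complement of weights at least
  \<open>1 - k\<close>, since weight a pairs only with weight -a. In \<open>x = a + b\<close> the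
  part \<open>b\<close> of weights below k is orthogonal to weights at most -k by weight, and to the
  others by hypothesis, so it is zero.\<close>

lemma strings_geI:
  assumes orth: "\<And>u n j. u \<in> L n \<Longrightarrow> j \<le> n \<Longrightarrow> 1 - k \<le> 2 * int j - int n \<Longrightarrow> \<Phi> x ((e ^^ j) u) = 0"
  shows "x \<in> strings_ge k"
proof -
  define lower where "lower = {(e ^^ j) v | j v m. v \<in> L m \<and> j \<le> m \<and> 2 * int j - int m < k}"
  define upper where "upper = {(e ^^ j) v | j v m. v \<in> L m \<and> j \<le> m \<and> k \<le> 2 * int j - int m}"
  have "strings \<subseteq> upper \<union> lower" by (force simp: lower_def upper_def)
  then have "span (upper \<union> lower) = UNIV"
    using low.span_strings span_mono[of strings "upper \<union> lower"] by auto
  then obtain a b where x: "x = a + b" "a \<in> strings_ge k" "b \<in> span lower"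
    unfolding span_Un strings_ge_def upper_def by blast
  have b_orth: "\<Phi> b ((e ^^ i) u) = 0" if u: "u \<in> L n" "2 * int i - int n \<le> - k" for u n i
    using x(3)
  proof (induction b rule: span_inductI)
    case (base b)
    then show ?case using form_strings_zero[OF _ u(1)] u(2) by (force simp: lower_def)
  qed (auto simp: \<Phi>'.zero \<Phi>'.add \<Phi>'.scale)
  have "b = 0"
  proof (rule zero_if_form_strings_zero)
    fix u m j assume u: "u \<in> L m" "j \<le> m"
    have "\<Phi> b ((e ^^ j) u) = 0"
    proof (cases "1 - k \<le> 2 * int j - int m")
      case True
      then show ?thesis
        using orth[OF u] form_strings_ge[OF x(2) u(1), of j] by (simp add: x(1) \<Phi>'.add)
    qed (use b_orth u in auto)
    then show "\<Phi> ((e ^^ j) u) b = 0" by (simp add: form_sym[of _ b])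
  qed
  then show ?thesis using x by simp
qed

text \<open>For \<open>v\<close> in \<open>L m\<close> the vector \<open>y v\<close> has weights at
  least -m because \<open>e^(m+1) (y v) = 0\<close>. The hypothesis removes weight -m, so
  \<open>y\<close>, commuting with \<open>e\<close>, moves every step of the weight filtration into
  the next, although it need not commute with \<open>h\<close>.\<close>

lemma centralizer_nilpotent:
  assumes y: "y \<in> p_centralizer scale \<Phi> J e"
    and zero: "\<And>m u v. u \<in> L m \<Longrightarrow> v \<in> L m \<Longrightarrow> pairing m (y v) u = 0"
  shows "y \<in> nilpotent_cone scale \<Phi> J"
proof -
  have p: "y \<in> p_part scale \<Phi> J" and comm: "e (y v) = y (e v)" for v
    using p_centralizerD[OF y] by auto
  interpret y: Vector_Spaces.linear scale scale y using p by (simp add: p_part_iff)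
  have pow_comm: "(e ^^ j) (y v) = y ((e ^^ j) v)" for j v
    by (induction j) (simp_all add: comm)
  have y_L: "y v \<in> strings_ge (1 - int m)" if v: "v \<in> L m" for v m
  proof (rule strings_geI)
    fix u n j assume u: "u \<in> L n" "j \<le> n" "1 - (1 - int m) \<le> 2 * int j - int n"
    \<comment> \<open>For \<open>j > m\<close> already \<open>e^j v = 0\<close>, and
      \<open>j = m\<close> forces \<open>n = m\<close>; so the hypothesis is called upon only within
      a single \<open>L m\<close>.\<close>
    then have "m \<le> j" by simp
    show "\<Phi> (y v) ((e ^^ j) u) = 0"
    proof (cases "j = m")
      case True
      then have "n = m" using u by simp
      then show ?thesis using zero[OF _ v, of u] u True by (simp add: pairing_def)
    next
      case False
      then have "y ((e ^^ j) v) = 0" using pow_e_big[OF v] \<open>m \<le> j\<close> by (simp add: y.zero)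
      then have "\<Phi> ((e ^^ j) (y v)) u = 0" by (simp add: pow_comm \<Phi>'.zero)
      then show ?thesis by (simp add: form_pow_e)
    qed
  qed
  have step: "y x \<in> strings_ge (k + 1)" if "x \<in> strings_ge k" for x k
    using that unfolding strings_ge_def[of k]
  proof (induction x rule: span_inductI)
    case (base x)
    then obtain j v m where x: "x = (e ^^ j) v" "v \<in> L m" "k \<le> 2 * int j - int m" by blast
    have "y x \<in> strings_ge (1 - int m + 2 * int j)"
      using pow_e_strings_ge[OF y_L[OF x(2)], of j] by (simp add: x(1) pow_comm)
    then show ?case using strings_ge_antimono[of "k + 1" "1 - int m + 2 * int j"] x(3) by auto
  qed (auto simp: y.zero y.add y.scale strings_ge_def intro: span_zero span_add span_scale)
  have "strings \<subseteq> strings_ge (- int N)"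
  proof
    fix x assume "x \<in> strings"
    then obtain j v m where x: "x = (e ^^ j) v" "v \<in> L m" by blast
    show "x \<in> strings_ge (- int N)"
    proof (cases "N \<le> m")
      case True
      then have "v = 0" using L_trivial x(2) by blast
      then show ?thesis by (simp add: x(1) pow_e.zero strings_ge_def span_zero)
    qed (use x in \<open>auto intro: strings_ge_base\<close>)
  qed
  then have "span strings \<subseteq> strings_ge (- int N)"
    unfolding strings_ge_def by (rule span_minimal) (rule subspace_span)
  then have all: "x \<in> strings_ge (- int N)" for x using low.span_strings by blast
  have "(y ^^ i) x \<in> strings_ge (- int N + int i)" for i x
  proof (induction i)
    case (Suc i)
    then show ?case using step[OF Suc] by (simp add: algebra_simps)
  qed (simp add: all)
  \<comment> \<open>The filtration is everything at -N and zero at N, as \<open>L m\<close> vanishes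
    for \<open>m \<ge> N\<close>; hence 2N steps suffice.\<close>
  from this[of "2 * N"] have "(y ^^ (2 * N)) x \<in> strings_ge (int N)" for x by simp
  moreover have "strings_ge (int N) \<subseteq> {0}"
    unfolding strings_ge_def
  proof (rule span_minimal)
    show "{(e ^^ j) v | j v m. v \<in> L m \<and> j \<le> m \<and> int N \<le> 2 * int j - int m} \<subseteq> {0}"
    proof
      fix x assume "x \<in> {(e ^^ j) v | j v m. v \<in> L m \<and> j \<le> m \<and> int N \<le> 2 * int j - int m}"
      then obtain j v m where "x = (e ^^ j) v" "v \<in> L m" "N \<le> m" by force
      moreover from this have "v = 0" using L_trivial by blast
      ultimately show "x \<in> {0}" by (simp add: pow_e.zero)
    qed
  qed simp
  ultimately have "y ^^ (2 * N) = (\<lambda>_. 0)" by (auto simp: fun_eq_iff)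
  then show ?thesis using p by (auto simp: nilpotent_cone_def)
qed

end

section \<open>Splitting by the eigenvalues of \<open>J\<close>\<close>

locale normal_triple_eigen = normal_triple_space scale Basis \<Phi> J \<epsilon> e h f N
  for scale :: "'k::field_char_0 \<Rightarrow> 'v::ab_group_add \<Rightarrow> 'v" and Basis \<Phi> J \<epsilon> e h f N +
  fixes \<alpha> :: 'k
  assumes alpha_square: "\<alpha> * \<alpha> = - \<epsilon>"
begin

lemma alpha_nonzero: "\<alpha> \<noteq> 0" "\<alpha> \<noteq> - \<alpha>"
proof -
  show "\<alpha> \<noteq> 0"
    using alpha_square eps_square by auto
  then show "\<alpha> \<noteq> - \<alpha>" by (simp add: eq_neg_iff_add_eq_0 flip: mult_2)
qed

lemma sgn_of_cases: "sgn_of m = 1 \<or> sgn_of m = - 1"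
  using sgn_of_square(1)[of m] square_eq_1_iff by blast

definition LE :: "'k \<Rightarrow> nat \<Rightarrow> 'v set" where
  "LE \<nu> m = {v \<in> L m. J v = scale \<nu> v}"

lemma subspace_LE: "subspace (LE \<nu> m)"
proof -
  have "subspace {v. J v = scale \<nu> v}"
    by (auto simp: subspace_def J.add J.scale scale_right_distrib scale_left_commute)
  moreover have "LE \<nu> m = L m \<inter> {v. J v = scale \<nu> v}" by (auto simp: LE_def)
  ultimately show ?thesis using low.subspace_highest subspace_inter by simp
qed

lemma J_L: "v \<in> L m \<Longrightarrow> J v \<in> L m"
  unfolding L_iff using J_f[of v] J_h[of v] by (simp add: J.scale J.zero J.neg)

lemma L_decomposition:
  assumes "v \<in> L m"
  obtains a b where "v = a + b" "a \<in> LE \<alpha> m" "b \<in> LE (- \<alpha>) m"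
proof
  define c where "c = inverse \<alpha>"
  have c: "c * \<alpha> = 1" "c * \<epsilon> = - \<alpha>"
  proof -
    show "c * \<alpha> = 1" using alpha_nonzero by (simp add: c_def)
    have "c * \<epsilon> = - ((c * \<alpha>) * \<alpha>)" using alpha_square by (simp add: mult.assoc)
    then show "c * \<epsilon> = - \<alpha>" by (simp add: \<open>c * \<alpha> = 1\<close>)
  qed
  have JcJ: "J (scale c (J v)) = scale \<alpha> v"
    by (simp add: J.scale J_J c)
  define a where "a = scale (1/2) (v + scale c (J v))"
  define b where "b = scale (1/2) (v - scale c (J v))"
  show "v = a + b"
    by (simp add: a_def b_def scale_half_double flip: scale_right_distrib)
  have "a \<in> L m" "b \<in> L m"
    using assms J_L[OF assms] low.subspace_highest unfolding a_def b_def
    by (auto intro!: subspace_scale subspace_add subspace_diff)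
  moreover have "\<alpha> * c = 1" using c(1) by (simp add: mult.commute)
  then have "J a = scale \<alpha> a" "J b = - scale \<alpha> b"
    unfolding a_def b_def J.scale[of "1/2"] J.add J.diff JcJ scale_left_commute[of \<alpha> "1/2"]
      scale_right_distrib[of \<alpha>] scale_right_diff_distrib[of \<alpha>] scale_scale[of \<alpha> c]
      scale_minus_right[symmetric]
    by (simp_all add: add.commute)
  ultimately show "a \<in> LE \<alpha> m" "b \<in> LE (- \<alpha>) m" by (auto simp: LE_def)
qed

lemma pairing_LE_zero:
  "u \<in> LE \<nu> m \<Longrightarrow> v \<in> LE \<mu> m \<Longrightarrow> \<nu> \<noteq> - (sgn_of m * \<mu>) \<Longrightarrow> pairing m u v = 0"
  by (auto simp: LE_def intro: pairing_eigen)

lemma pairing_LE_nondeg: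
  assumes \<nu>: "\<nu> = \<alpha> \<or> \<nu> = - \<alpha>" and v: "v \<in> LE \<nu> m"
    and zero: "\<And>u. u \<in> LE (- (sgn_of m * \<nu>)) m \<Longrightarrow> pairing m u v = 0"
  shows "v = 0"
proof (rule pairing_nondeg)
  show "v \<in> L m" using v by (simp add: LE_def)
  fix u assume "u \<in> L m"
  then obtain a b where u: "u = a + b" "a \<in> LE \<alpha> m" "b \<in> LE (- \<alpha>) m"
    by (rule L_decomposition)
  have "pairing m a v = 0" "pairing m b v = 0"
    using zero u v pairing_LE_zero by metis+
  then show "pairing m u v = 0" by (simp add: u(1) pairing_linear)
qed

lemma dual_vector:
  assumes \<nu>: "\<nu> = \<alpha> \<or> \<nu> = - \<alpha>" and v: "v \<in> LE \<nu> m" "v \<noteq> 0"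
  shows "\<exists>u\<in>LE (- (sgn_of m * \<nu>)) m. pairing m u v = 1"
proof -
  obtain u where u: "u \<in> LE (- (sgn_of m * \<nu>)) m" "pairing m u v \<noteq> 0"
    using pairing_LE_nondeg[OF \<nu> v(1)] v(2) by blast
  then show ?thesis
    by (intro bexI[of _ "scale (inverse (pairing m u v)) u"] subspace_scale[OF subspace_LE])
       (simp_all add: pairing_linear)
qed

text \<open>Gram-Schmidt: \<open>u0\<close> is dual to \<open>w\<close>, and \<open>u1\<close> to
  the part of \<open>v\<close> orthogonal to \<open>u0\<close>. Subtracting from \<open>u1\<close>
  the multiple of \<open>u0\<close> that cancels its value at \<open>w\<close> gives the value 1 at
  \<open>v\<close>.\<close>

lemma dual_vector_orthogonal:
  assumes \<nu>: "\<nu> = \<alpha> \<or> \<nu> = - \<alpha>" and v: "v \<in> LE \<nu> m" and w: "w \<in> LE \<nu> m"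
    and indep: "\<And>c. v \<noteq> scale c w" and "w \<noteq> 0"
  shows "\<exists>u\<in>LE (- (sgn_of m * \<nu>)) m. pairing m u v = 1 \<and> pairing m u w = 0"
proof -
  obtain u0 where u0: "u0 \<in> LE (- (sgn_of m * \<nu>)) m" "pairing m u0 w = 1"
    using dual_vector[OF \<nu> w \<open>w \<noteq> 0\<close>] by blast
  have "v - scale (pairing m u0 v) w \<noteq> 0" using indep by simp
  moreover have "v - scale (pairing m u0 v) w \<in> LE \<nu> m"
    using v w by (intro subspace_diff subspace_scale subspace_LE)
  ultimately obtain u1 where u1: "u1 \<in> LE (- (sgn_of m * \<nu>)) m"
    "pairing m u1 (v - scale (pairing m u0 v) w) = 1"
    using dual_vector[OF \<nu>] by blast
  show ?thesis
  proof (intro bexI conjI)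
    show "u1 - scale (pairing m u1 w) u0 \<in> LE (- (sgn_of m * \<nu>)) m"
      using u0 u1 by (intro subspace_diff subspace_scale subspace_LE)
    show "pairing m (u1 - scale (pairing m u1 w) u0) v = 1"
      using u1(2) by (simp add: pairing_linear mult.commute)
    show "pairing m (u1 - scale (pairing m u1 w) u0) w = 0"
      using u0(2) by (simp add: pairing_linear)
  qed
qed

lemma dim_LE_ge_2:
  assumes "2 \<le> dim (LE \<nu> m)"
  obtains v w where "v \<in> LE \<nu> m" "w \<in> LE \<nu> m" "w \<noteq> 0" "v \<noteq> 0" "\<And>c. v \<noteq> scale c w" "\<And>c. w \<noteq> scale c v"
proof -
  obtain w where w: "w \<in> LE \<nu> m" "w \<noteq> 0"
    using assms by (metis dim_eq_0 not_numeral_le_zero subsetI singleton_iff)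
  have "\<not> LE \<nu> m \<subseteq> span {w}"
    using assms dim_le_card[of "LE \<nu> m" "{w}"] by auto
  then obtain v where v: "v \<in> LE \<nu> m" "v \<notin> span {w}" by blast
  have "v \<noteq> scale c w" for c using v(2) by (auto simp: span_singleton)
  moreover have "w \<noteq> scale c v" for c
  proof
    assume wc: "w = scale c v"
    then have "c \<noteq> 0" using w(2) by auto
    then have "v = scale (inverse c) w" by (simp add: wc)
    then show False using v(2) by (auto simp: span_singleton)
  qed
  moreover have "v \<noteq> 0" using v(2) by (auto simp: span_zero)
  ultimately show ?thesis using that w v by blast
qed

lemma dim_LE_nonzero_iff: "dim (LE \<nu> m) \<noteq> 0 \<longleftrightarrow> (\<exists>v\<in>LE \<nu> m. v \<noteq> 0)"
  by auto

definition good_length :: "nat \<Rightarrow> bool" where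
  "good_length m \<longleftrightarrow> (if sgn_of m = 1
     then dim (LE \<alpha> m) + dim (LE (- \<alpha>) m) = 0 \<or> dim (LE \<alpha> m) + dim (LE (- \<alpha>) m) = 2
     else dim (LE \<alpha> m) = 0 \<or> dim (LE (- \<alpha>) m) = 0)"

lemma symmetric_length_both:
  assumes "sgn_of m = 1" "\<nu> = \<alpha> \<or> \<nu> = - \<alpha>" "dim (LE \<nu> m) \<noteq> 0"
  shows "dim (LE (- \<nu>) m) \<noteq> 0"
proof -
  obtain v where "v \<in> LE \<nu> m" "v \<noteq> 0" using assms(3) dim_LE_nonzero_iff by blast
  then obtain u where u: "u \<in> LE (- \<nu>) m" "pairing m u v = 1"
    using dual_vector[OF assms(2)] assms(1) by fastforce
  then have "u \<noteq> 0" by (auto simp: pairing_def \<Phi>'.zero)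
  then show ?thesis using u dim_LE_nonzero_iff by blast
qed

text \<open>A symmetric pairing puts the two eigenspaces in duality, so the splittings 2 + 0 and 0 +
  2 are excluded.\<close>

lemma two_rows_both_letters:
  assumes "sgn_of m = 1" "dim (LE \<alpha> m) + dim (LE (- \<alpha>) m) = 2"
  shows "dim (LE \<alpha> m) = 1" "dim (LE (- \<alpha>) m) = 1"
proof -
  have "a = 1 \<and> b = 1" if "a \<noteq> 0 \<Longrightarrow> b \<noteq> 0" "b \<noteq> 0 \<Longrightarrow> a \<noteq> 0" "a + b = 2" for a b :: nat
    using that by presburger
  from this[of "dim (LE \<alpha> m)" "dim (LE (- \<alpha>) m)"]
  show "dim (LE \<alpha> m) = 1" "dim (LE (- \<alpha>) m) = 1"
    using symmetric_length_both[OF assms(1), of \<alpha>] symmetric_length_both[OF assms(1), of "- \<alpha>"] assms(2)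
    by simp_all
qed

section \<open>Violations of the condition on the diagram\<close>

abbreviation obstructed :: bool where
  "obstructed \<equiv> \<not> p_centralizer scale \<Phi> J e \<subseteq> nilpotent_cone scale \<Phi> J \<and>
     (\<exists>y\<in>p_centralizer scale \<Phi> J e. lie_bracket h y = (\<lambda>_. 0) \<and>
        y \<in> nilpotent_cone scale \<Phi> J \<and> y \<noteq> (\<lambda>_. 0))"

text \<open>When the pairing is symmetric each eigenspace is isotropic, so two independent vectors
  of one eigenspace span an isotropic plane, and their dual vectors come from the other
  eigenspace.\<close>

lemma symmetric_obstruction:
  assumes s: "sgn_of m = 1" and \<nu>: "\<nu> = \<alpha> \<or> \<nu> = - \<alpha>" and "2 \<le> dim (LE \<nu> m)"
  shows obstructed
proof -
  obtain u w where uw: "u \<in> LE \<nu> m" "w \<in> LE \<nu> m" "w \<noteq> 0" "u \<noteq> 0"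
    "\<And>c. u \<noteq> scale c w" "\<And>c. w \<noteq> scale c u"
    using dim_LE_ge_2[OF assms(3)] by blast
  obtain u' where u': "u' \<in> LE (- \<nu>) m" "pairing m u' u = 1" "pairing m u' w = 0"
    using dual_vector_orthogonal[OF \<nu> uw(1,2,5,3)] s by auto
  obtain w' where w': "w' \<in> LE (- \<nu>) m" "pairing m w' w = 1" "pairing m w' u = 0"
    using dual_vector_orthogonal[OF \<nu> uw(2,1,6,4)] s by auto
  have ne: "\<nu> \<noteq> - \<nu>" using \<nu> alpha_nonzero by auto
  have zero: "pairing m x y = 0" if "x \<in> LE \<mu> m" "y \<in> LE \<mu> m" "\<mu> = \<nu> \<or> \<mu> = - \<nu>" for x y \<mu>
    using that ne s by (intro pairing_LE_zero[OF that(1,2)]) auto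
  show ?thesis
    using hyperbolic_obstruction[of u m w u' w' \<nu> "- \<nu>"] uw(1,2) u' w' s zero[of u \<nu> u]
      zero[of u \<nu> w] zero[of w \<nu> w] zero[of u' "- \<nu>" u'] zero[of u' "- \<nu>" w']
    by (simp add: LE_def)
qed

text \<open>When the pairing is alternating every vector is isotropic and the two eigenspaces are
  orthogonal, so one vector from each spans an isotropic plane, with each dual vector taken in the
  same eigenspace as its partner.\<close>

lemma alternating_obstruction:
  assumes s: "sgn_of m = - 1" and "dim (LE \<alpha> m) \<noteq> 0" "dim (LE (- \<alpha>) m) \<noteq> 0"
  shows obstructed
proof -
  obtain u w where uw: "u \<in> LE \<alpha> m" "u \<noteq> 0" "w \<in> LE (- \<alpha>) m" "w \<noteq> 0"
    using assms dim_LE_nonzero_iff by blast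
  obtain u' where u': "u' \<in> LE \<alpha> m" "pairing m u' u = 1"
    using dual_vector[OF _ uw(1,2)] s by auto
  obtain w' where w': "w' \<in> LE (- \<alpha>) m" "pairing m w' w = 1"
    using dual_vector[OF _ uw(3,4)] s by auto
  have self: "pairing m x x = 0" for x
  proof (rule eq_minus_self)
    show "pairing m x x = - pairing m x x"
      by (subst pairing_sym) (simp add: s)
  qed
  have zero: "pairing m x y = 0" "pairing m y x = 0" if "x \<in> LE \<alpha> m" "y \<in> LE (- \<alpha>) m" for x y
    using that alpha_nonzero s pairing_LE_zero[of x \<alpha> m y "- \<alpha>"] pairing_LE_zero[of y "- \<alpha>" m x \<alpha>]
    by auto
  show ?thesis
    using hyperbolic_obstruction[of u m w u' w' \<alpha> \<alpha>] uw u' w' s self zero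
    by (simp add: LE_def)
qed

lemma not_good_obstructed: "\<not> good_length m \<Longrightarrow> obstructed"
proof -
  assume bad: "\<not> good_length m"
  show ?thesis
  proof (cases "sgn_of m = 1")
    case True
    \<comment> \<open>The two dimensions vanish together, so a total other than 0 and 2 rules out
      that both are at most 1.\<close>
    then have "2 \<le> dim (LE \<alpha> m) \<or> 2 \<le> dim (LE (- \<alpha>) m)"
      using bad symmetric_length_both[OF True, of \<alpha>] symmetric_length_both[OF True, of "- \<alpha>"]
      unfolding good_length_def by (simp del: dim_eq_0) linarith
    then show ?thesis using symmetric_obstruction[OF True] by blast
  next
    case False
    then have "sgn_of m = - 1" using sgn_of_cases by blast
    then show ?thesis
      using False bad alternating_obstruction unfolding good_length_def by simp
  qed
qed

text \<open>As \<open>y\<close> is skew, the form \<open>pairing m (y v) u\<close> has the symmetry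
  opposite to that of \<open>pairing m\<close>; as \<open>y\<close> anticommutes with
  \<open>J\<close>, it links the eigenvalue \<open>\<mu>\<close> of u only with the eigenvalue
  \<open>sgn_of m * \<mu>\<close> of v. For sign 1 it is alternating on a single eigenspace, of
  dimension at most one; for sign -1 it links different eigenspaces, one of which is zero.\<close>

lemma good_nilpotent:
  assumes good: "\<And>m. good_length m" and y: "y \<in> p_centralizer scale \<Phi> J e"
  shows "y \<in> nilpotent_cone scale \<Phi> J"
proof (rule centralizer_nilpotent[OF y])
  have p: "y \<in> p_part scale \<Phi> J" and comm: "e (y v) = y (e v)" for v
    using p_centralizerD[OF y] by auto
  interpret y: Vector_Spaces.linear scale scale y using p by (simp add: p_part_iff)
  have skew: "\<Phi> (y u) v = - \<Phi> u (y v)" and J_y: "J (y v) = - y (J v)" for u v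
    using p by (simp_all add: p_part_iff)
  have pow_comm: "(e ^^ j) (y v) = y ((e ^^ j) v)" for j v
    by (induction j) (simp_all add: comm)
  fix m
  have B_sym: "pairing m (y v) u = - (sgn_of m * pairing m (y u) v)" for u v
  proof -
    have "pairing m (y v) u = - pairing m v (y u)"
      by (simp add: pairing_def skew pow_comm)
    then show ?thesis by (simp add: pairing_sym[of m v])
  qed
  have zero_eigen: "pairing m (y v) u = 0"
    if v: "v \<in> LE \<nu> m" and u: "u \<in> LE \<mu> m" and "\<nu> \<in> {\<alpha>, - \<alpha>}" "\<mu> \<in> {\<alpha>, - \<alpha>}" for u v \<nu> \<mu>
  proof (cases "\<nu> = sgn_of m * \<mu>")
    case False
    have "J (y v) = scale (- \<nu>) (y v)" using v by (simp add: LE_def J_y y.scale)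
    then show ?thesis using u False by (intro pairing_eigen[of _ "- \<nu>" _ \<mu>]) (auto simp: LE_def)
  next
    case \<nu>: True
    show ?thesis
    proof (cases "sgn_of m = 1")
      case True
      then have "\<nu> = \<mu>" using \<nu> by simp
      have "dim (LE \<nu> m) \<le> 1"
        using good[of m] True two_rows_both_letters[OF True] that(3)
        unfolding good_length_def by (auto simp del: dim_eq_0)
      obtain b where b: "LE \<nu> m \<subseteq> span {b}"
      proof -
        obtain B where B: "independent B" "LE \<nu> m \<subseteq> span B" "card B = dim (LE \<nu> m)"
          by (rule basis_exists)
        then have "card B \<le> 1" "finite B" using \<open>dim _ \<le> 1\<close> finiteI_independent by auto
        then have "B = {} \<or> (\<exists>b. B = {b})" by (metis card_0_eq card_1_singletonE le_Suc_eq le_zero_eq One_nat_def)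
        then obtain b where "B \<subseteq> {b}" by blast
        then show ?thesis using that B(2) span_mono by blast
      qed
      have "v \<in> range (\<lambda>k. scale k b)" "u \<in> range (\<lambda>k. scale k b)"
        using b u v \<open>\<nu> = \<mu>\<close> unfolding span_singleton by auto
      then obtain c d where "v = scale c b" "u = scale d b" by blast
      moreover have "pairing m (y b) b = 0"
      proof (rule eq_minus_self)
        show "pairing m (y b) b = - pairing m (y b) b"
          by (subst B_sym) (simp add: True)
      qed
      ultimately show ?thesis by (simp add: pairing_linear y.scale)
    next
      case False
      then have s: "sgn_of m = - 1" using sgn_of_cases by blast
      then have "LE \<nu> m \<subseteq> {0} \<or> LE \<mu> m \<subseteq> {0}"
        using good[of m] False that(3,4) \<nu> unfolding good_length_def by auto
      then have "v = 0 \<or> u = 0" using u v by blast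
      then show ?thesis by (auto simp: pairing_def y.zero pow_e.zero \<Phi>.zero \<Phi>'.zero)
    qed
  qed
  fix u v assume "u \<in> L m" "v \<in> L m"
  then obtain a b c d where "u = a + b" "a \<in> LE \<alpha> m" "b \<in> LE (- \<alpha>) m"
    "v = c + d" "c \<in> LE \<alpha> m" "d \<in> LE (- \<alpha>) m"
    by (metis L_decomposition)
  then show "pairing m (y v) u = 0"
    using zero_eigen[of c \<alpha> a \<alpha>] zero_eigen[of c \<alpha> b "- \<alpha>"] zero_eigen[of d "- \<alpha>" a \<alpha>]
      zero_eigen[of d "- \<alpha>" b "- \<alpha>"]
    by (simp add: pairing_linear y.add)
qed

end

subsection \<open>The diagram\<close>

context normal_triple_eigen begin

lemma p_distinguished_iff: "p_distinguished scale \<Phi> J e \<longleftrightarrow> (\<forall>m. good_length m)"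
  unfolding p_distinguished_def using not_good_obstructed good_nilpotent by blast

lemma almost_p_distinguished_imp:
  assumes nt: "normal_triple scale \<Phi> J e = (h, f)" and almost: "almost_p_distinguished scale \<Phi> J e"
  shows "p_distinguished scale \<Phi> J e"
proof (rule ccontr)
  assume "\<not> p_distinguished scale \<Phi> J e"
  then obtain y where y: "y \<in> p_centralizer scale \<Phi> J e" "lie_bracket h y = (\<lambda>_. 0)"
    "y \<in> nilpotent_cone scale \<Phi> J" "y \<noteq> (\<lambda>_. 0)"
    using not_good_obstructed p_distinguished_iff by blast
  then have "y \<in> p_reductive_part scale \<Phi> J e"
    by (simp add: p_reductive_part_def nt p_centralizer_def)
  then show False using almost y by (auto simp: almost_p_distinguished_def)
qed

lemma lowest_weight_space_eq:
  "normal_triple scale \<Phi> J e = (h, f) \<Longrightarrow> lowest_weight_space scale \<Phi> J e (Suc m) = L m"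
  by (auto simp: lowest_weight_space_def L_iff)

lemma ab_diagram_eq:
  assumes "normal_triple scale \<Phi> J e = (h, f)"
    and "Va = {v. J v = scale \<alpha> v}" "Vb = {v. J v = scale (- \<alpha>) v}"
  shows "ab_diagram scale \<Phi> J Va Vb e (Suc m) LetterA = dim (LE \<alpha> m)"
    and "ab_diagram scale \<Phi> J Va Vb e (Suc m) LetterB = dim (LE (- \<alpha>) m)"
  unfolding ab_diagram_def lowest_weight_space_eq[OF assms(1)]
  by (auto simp: assms LE_def intro!: arg_cong[of _ _ dim])

end

text \<open>For \<open>e = 0\<close> the triple (0, 0, 0) satisfies all the relations and
  \<open>L 0\<close> is V, so this case needs no separate treatment afterwards.\<close>

lemma (in polarized_space) normal_triple_is_normal_triple:
  assumes "e \<in> p_part scale \<Phi> J" "\<And>x. (e ^^ N) x = 0"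
  shows "is_normal_triple scale \<Phi> J e (fst (normal_triple scale \<Phi> J e)) (snd (normal_triple scale \<Phi> J e))"
proof (cases "e = (\<lambda>_. 0)")
  case True
  have "(\<lambda>_. 0) \<in> k_part scale \<Phi> J" "(\<lambda>_. 0) \<in> p_part scale \<Phi> J"
    by (simp_all add: k_part_iff p_part_iff Vector_Spaces.linear_iff vector_space_axioms
        \<Phi>.zero \<Phi>'.zero J.zero)
  then show ?thesis
    using True by (simp add: normal_triple_def is_normal_triple_def lie_bracket_def)
next
  case False
  obtain h f where "is_normal_triple scale \<Phi> J e h f"
    using normal_triple_exists[OF assms] by blast
  then have "case (h, f) of (h, f) \<Rightarrow> is_normal_triple scale \<Phi> J e h f" by simp
  then have "case normal_triple scale \<Phi> J e of (h, f) \<Rightarrow> is_normal_triple scale \<Phi> J e h f"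
    using False unfolding normal_triple_def by (simp only: if_False) (rule someI)
  then show ?thesis by (simp add: case_prod_beta)
qed

section \<open>Both types as instances of one setting\<close>

lemma (in simple_symmetric_pair) polarized_spaceI:
  assumes "\<epsilon> * \<epsilon> = 1" "\<And>u v. \<Phi> u v = \<epsilon> * \<Phi> v u" "\<And>v. J (J v) = scale (- \<epsilon>) v"
  shows "polarized_space scale Basis \<Phi> J \<epsilon>"
proof (intro polarized_space.intro polarized_space_axioms.intro)
  show "Vector_Spaces.linear scale (*) (\<Phi> u)" "Vector_Spaces.linear scale (*) (\<lambda>u. \<Phi> u v)" for u v
    using form_bilinear by (auto simp: bilinear_form_def)
  show "v = 0" if "\<And>u. \<Phi> u v = 0" for v
    using form_nondegenerate that by (auto simp: nondegenerate_form_def)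
qed (fact finite_dimensional_vector_space_axioms J_linear J_preserves assms)+

lemma (in simple_symmetric_pair) type_CII_polarized:
  assumes "type_CII \<Phi> J"
  shows "polarized_space scale Basis \<Phi> J (- 1)"
proof (rule polarized_spaceI)
  have alt: "\<Phi> v v = 0" for v using assms by (simp add: type_CII_def)
  show "\<Phi> u v = - 1 * \<Phi> v u" for u v
  proof -
    interpret r: Vector_Spaces.linear scale "(*)" "\<Phi> (u + v)"
      using form_bilinear by (simp add: bilinear_form_def)
    interpret lu: Vector_Spaces.linear scale "(*)" "\<lambda>x. \<Phi> x u"
      using form_bilinear by (simp add: bilinear_form_def)
    interpret lv: Vector_Spaces.linear scale "(*)" "\<lambda>x. \<Phi> x v"
      using form_bilinear by (simp add: bilinear_form_def)
    have "\<Phi> (u + v) (u + v) = \<Phi> u u + \<Phi> v u + (\<Phi> u v + \<Phi> v v)"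
      by (simp only: r.add lu.add lv.add)
    then have "\<Phi> u v + \<Phi> v u = 0" by (simp add: alt add.commute)
    then show ?thesis by (simp add: eq_neg_iff_add_eq_0)
  qed
qed (use assms in \<open>simp_all add: type_CII_def\<close>)

lemma (in simple_symmetric_pair) type_DIII_polarized:
  assumes "type_DIII \<Phi> J"
  shows "polarized_space scale Basis \<Phi> J 1"
  by (rule polarized_spaceI) (use assms in \<open>auto simp: type_DIII_def\<close>)

text \<open>The square of \<open>J\<close> determines that of \<open>\<alpha>\<close> as soon as
  \<open>\<alpha>\<close> has an eigenvector. Otherwise every vector belongs to
  \<open>\<beta>\<close>, so \<open>J\<close> is scalar and \<open>theta J\<close> is
  trivial.\<close>

lemma (in simple_symmetric_pair) eigenvalue_square:
  assumes J_J: "\<And>v. J (J v) = scale (- \<epsilon>) v"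
    and dec: "\<And>v. \<exists>a b. J a = scale \<alpha> a \<and> J b = scale \<beta> b \<and> v = a + b"
  shows "\<alpha> * \<alpha> = - \<epsilon>"
proof -
  interpret J: Vector_Spaces.linear scale scale J by (rule J_linear)
  have "\<exists>a. J a = scale \<alpha> a \<and> a \<noteq> 0"
  proof (rule ccontr)
    assume no: "\<nexists>a. J a = scale \<alpha> a \<and> a \<noteq> 0"
    have J: "J v = scale \<beta> v" for v using dec[of v] no by auto
    obtain x where x: "x \<in> aut_algebra scale \<Phi>" "theta J x \<noteq> x" using theta_nontrivial by blast
    then interpret x: Vector_Spaces.linear scale scale x by (simp add: aut_algebra_def)
    have "theta J x (J w) = x (J w)" for w
    proof -
      have "theta J x (J w) = J (x w)" by (simp add: theta_def bij_is_inj[OF J_bij])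
      also have "\<dots> = x (J w)" unfolding J x.scale ..
      finally show ?thesis .
    qed
    moreover have "\<exists>w. v = J w" for v using J_bij by (meson bij_pointE)
    ultimately have "theta J x = x" by (metis ext)
    then show False using x by simp
  qed
  then obtain a where a: "J a = scale \<alpha> a" "a \<noteq> 0" by blast
  then have "scale (\<alpha> * \<alpha>) a = scale (- \<epsilon>) a"
    using J_J[of a] by (simp add: J.scale)
  then show ?thesis using a(2) by (simp only: scale_cancel_right) simp
qed

lemma same_first_letter_iff: "same_first_letter D d \<longleftrightarrow> D d LetterA = 0 \<or> D d LetterB = 0"
  unfolding same_first_letter_def by (metis ab_letter.exhaust ab_letter.distinct(1))

lemma all_ge_1_iff: "(\<forall>d\<ge>1. P d) \<longleftrightarrow> (\<forall>m. P (Suc m))"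
  by (metis One_nat_def Suc_le_D le_add1 plus_1_eq_Suc)

text \<open>The statement for both types at once, with \<open>m = d - 1\<close>. The two eigenvalues
  are distinct with the same square, hence opposite, whichever of them is given the letter
  a.\<close>

lemma (in simple_symmetric_pair) ab_diagram_p_distinguished:
  assumes pol: "polarized_space scale Basis \<Phi> J \<epsilon>"
    and dec: "eigenspace_decomposition scale J Va Vb"
    and e: "e \<in> nilpotent_cone scale \<Phi> J"
  defines "D \<equiv> ab_diagram scale \<Phi> J Va Vb e"
  shows "p_distinguished scale \<Phi> J e \<longleftrightarrow> (\<forall>m. if (-1) ^ m * \<epsilon> = 1
      then rows_of_length D (Suc m) = 0 \<or> rows_of_length D (Suc m) = 2
      else same_first_letter D (Suc m))"
    and "\<And>m. (-1) ^ m * \<epsilon> = 1 \<Longrightarrow> rows_of_length D (Suc m) = 2 \<Longrightarrow>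
      D (Suc m) LetterA = 1 \<and> D (Suc m) LetterB = 1"
    and "almost_p_distinguished scale \<Phi> J e \<Longrightarrow> p_distinguished scale \<Phi> J e"
proof -
  interpret pol: polarized_space scale Basis \<Phi> J \<epsilon> by (rule pol)
  obtain \<alpha> \<beta> where V: "\<alpha> \<noteq> \<beta>" "Va = {v. J v = scale \<alpha> v}" "Vb = {v. J v = scale \<beta> v}"
    and sum: "\<And>v. \<exists>a\<in>Va. \<exists>b\<in>Vb. v = a + b"
    using dec unfolding eigenspace_decomposition_def by blast
  have "\<alpha> * \<alpha> = - \<epsilon>"
    using sum V by (intro eigenvalue_square[OF pol.J_J, of \<alpha> \<beta>]) blast
  moreover have "\<beta> * \<beta> = - \<epsilon>"
  proof (rule eigenvalue_square[OF pol.J_J])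
    fix v
    obtain a b where "a \<in> Va" "b \<in> Vb" "v = a + b" using sum by blast
    then show "\<exists>b a. J b = scale \<beta> b \<and> J a = scale \<alpha> a \<and> v = b + a"
      unfolding V by (auto simp: add.commute)
  qed
  ultimately have \<beta>: "\<beta> = - \<alpha>" using V(1) square_eq_iff[of \<alpha> \<beta>] by auto
  obtain N where N: "e ^^ N = (\<lambda>_. 0)" "e \<in> p_part scale \<Phi> J"
    using e by (auto simp: nilpotent_cone_def)
  obtain h f where nt: "normal_triple scale \<Phi> J e = (h, f)" by fastforce
  interpret normal_triple_eigen scale Basis \<Phi> J \<epsilon> e h f N \<alpha>
    using pol.normal_triple_is_normal_triple[OF N(2), of N] N nt \<open>\<alpha> * \<alpha> = - \<epsilon>\<close>
    by unfold_locales simp_all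
  have D: "D (Suc m) LetterA = dim (LE \<alpha> m)" "D (Suc m) LetterB = dim (LE (- \<alpha>) m)" for m
    unfolding D_def using ab_diagram_eq[OF nt V(2) V(3)[unfolded \<beta>]] by auto
  show "p_distinguished scale \<Phi> J e \<longleftrightarrow> (\<forall>m. if (-1) ^ m * \<epsilon> = 1
      then rows_of_length D (Suc m) = 0 \<or> rows_of_length D (Suc m) = 2
      else same_first_letter D (Suc m))"
    unfolding p_distinguished_iff good_length_def rows_of_length_def same_first_letter_iff D
      sgn_of_def ..
  show "D (Suc m) LetterA = 1 \<and> D (Suc m) LetterB = 1"
    if "(-1) ^ m * \<epsilon> = 1" "rows_of_length D (Suc m) = 2" for m
    using that two_rows_both_letters[of m] unfolding rows_of_length_def D sgn_of_def by auto
  show "p_distinguished scale \<Phi> J e" if "almost_p_distinguished scale \<Phi> J e"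
    using almost_p_distinguished_imp[OF nt that] .
qed

theorem proposition3p8:
  fixes scale :: "'k::{alg_closed_field, field_char_0} \<Rightarrow> 'v::ab_group_add \<Rightarrow> 'v"
    and Basis :: "'v set"
    and \<Phi> :: "'v \<Rightarrow> 'v \<Rightarrow> 'k"
    and J :: "'v \<Rightarrow> 'v"
    and Va Vb :: "'v set"
    and e :: "'v \<Rightarrow> 'v"
  defines "D \<equiv> ab_diagram scale \<Phi> J Va Vb e"
  assumes "simple_symmetric_pair scale Basis \<Phi> J"
    and "eigenspace_decomposition scale J Va Vb"
    and "e \<in> nilpotent_cone scale \<Phi> J"
  shows
    "(type_CII \<Phi> J \<longrightarrow>
        (p_distinguished scale \<Phi> J e \<longleftrightarrow>
           (\<forall>d\<ge>1. (even d \<longrightarrow> rows_of_length D d = 0 \<or> rows_of_length D d = 2) \<and>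
                   (odd d \<longrightarrow> same_first_letter D d))) \<and>
        (\<forall>d\<ge>1. even d \<and> rows_of_length D d = 2 \<longrightarrow> D d LetterA = 1 \<and> D d LetterB = 1)) \<and>
     (type_DIII \<Phi> J \<longrightarrow>
        (p_distinguished scale \<Phi> J e \<longleftrightarrow>
           (\<forall>d\<ge>1. (odd d \<longrightarrow> rows_of_length D d = 0 \<or> rows_of_length D d = 2) \<and>
                   (even d \<longrightarrow> same_first_letter D d))) \<and>
        (\<forall>d\<ge>1. odd d \<and> rows_of_length D d = 2 \<longrightarrow> D d LetterA = 1 \<and> D d LetterB = 1)) \<and>
     (type_CII \<Phi> J \<or> type_DIII \<Phi> J \<longrightarrow>
        almost_p_distinguished scale \<Phi> J e \<longrightarrow> p_distinguished scale \<Phi> J e)"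
proof -
  interpret simple_symmetric_pair scale Basis \<Phi> J by (rule assms(2))
  \<comment> \<open>Since \<open>d = m + 1\<close>, odd m means even length for CII, and even m
    means odd length for DIII.\<close>
  have sign: "(-1) ^ m * (- 1) = (1 :: 'k) \<longleftrightarrow> odd m" "(-1) ^ m * 1 = (1 :: 'k) \<longleftrightarrow> even m" for m
    by (auto simp: minus_one_power_iff)
  note CII = ab_diagram_p_distinguished[OF type_CII_polarized assms(3,4),
      folded D_def, unfolded sign]
  note DIII = ab_diagram_p_distinguished[OF type_DIII_polarized assms(3,4),
      folded D_def, unfolded sign]
  show ?thesis
    unfolding all_ge_1_iff using CII DIII by (auto split: if_splits)
qed

end
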